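(* Let $T$ be a homogeneous tree with branching number $b$. Let $\{A_t:t\in T\}$ be a family of measurable events in a probability space $(\Omega,\Sigma,\mu)$ satisfying $\mu(A_t)\geq\varepsilon>0$ for every $t\in T$. Then for every $0<\theta<\varepsilon$ there exists a strong subtree $S$ of $T$ of infinite height such that for every integer $k\geq 1$ and every strong subtree $R$ of $S$ of height $k$ we have $$\mu\Big(\bigcap_{t\in R}A_t\Big)\geq\theta^{p(b,k)},\qquad\text{where } p(b,k)=\frac{(2^b-1)^k-1}{2^b-2}.$$
   Context: A tree is a non-empty partially ordered set $(T,<)$ such that for every $t\in T$ the set $\{s\in T:s<t\}$ is finite and linearly ordered; its cardinality is the length $\ell_T(t)$ of $t$. For $n\in\mathbb{N}=\{0,1,2,\dots\}$ the $n$-level is $T(n)=\{t\in T:\ell_T(t)=n\}$. The height $h(T)$ is $\max\{n:T(n)\neq\emptyset\}+1$ if some level is empty, and $\infty$ otherwise. The immediate successors of $t$ in $T$ are the $s\geq t$ with $\ell_T(s)=\ell_T(t)+1$; write $\mathrm{ImmSucc}_T(t)$ for the set of them. $T$ is uniquely rooted if $|T(0)|=1$, and balanced if all maximal chains of $T$ have the same cardinality. A subtree of $T$ is a subset of $T$ with the induced order. A tree $T$ is homogeneous if it is uniquely rooted and there is an integer $b\geq 2$ (the branching number of $T$) such that every $t\in T$ has exactly $b$ immediate successors. A (finite or infinite) subtree $S$ of a uniquely rooted tree $T$ is strong if: (a) $S$ is uniquely rooted and balanced; (b) every level of $S$ is a subset of some level of $T$; (c) for every non-maximal node $s\in S$ and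 every $t\in\mathrm{ImmSucc}_T(s)$ there is a unique $s'\in\mathrm{ImmSucc}_S(s)$ with $t\leq s'$. *)

theory Defs
  imports "HOL-Probability.Probability" "HOL-Library.Equipollence" "HOL-Library.Extended_Nat"
begin

(* A tree is a carrier set T together with a strict order lt on it; a subtree is a
   subset of T, with the same relation lt. *)

definition tree_on :: "('a \<Rightarrow> 'a \<Rightarrow> bool) \<Rightarrow> 'a set \<Rightarrow> bool" where
  "tree_on lt T \<longleftrightarrow>
     T \<noteq> {} \<and> irreflp_on T lt \<and> transp_on T lt \<and>
     (\<forall>t\<in>T. finite {s \<in> T. lt s t} \<and> totalp_on {s \<in> T. lt s t} lt)"

definition node_length :: "('a \<Rightarrow> 'a \<Rightarrow> bool) \<Rightarrow> 'a set \<Rightarrow> 'a \<Rightarrow> nat" where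
  "node_length lt T t = card {s \<in> T. lt s t}"

definition tree_level :: "('a \<Rightarrow> 'a \<Rightarrow> bool) \<Rightarrow> 'a set \<Rightarrow> nat \<Rightarrow> 'a set" where
  "tree_level lt T n = {t \<in> T. node_length lt T t = n}"

definition tree_height :: "('a \<Rightarrow> 'a \<Rightarrow> bool) \<Rightarrow> 'a set \<Rightarrow> enat" where
  "tree_height lt T =
     (if \<exists>n. tree_level lt T n = {}
      then enat (Max {n. tree_level lt T n \<noteq> {}} + 1)
      else \<infinity>)"

definition imm_succ :: "('a \<Rightarrow> 'a \<Rightarrow> bool) \<Rightarrow> 'a set \<Rightarrow> 'a \<Rightarrow> 'a set" where
  "imm_succ lt T t =
     {s \<in> T. lt\<^sup>=\<^sup>= t s \<and> node_length lt T s = node_length lt T t + 1}"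

definition uniquely_rooted :: "('a \<Rightarrow> 'a \<Rightarrow> bool) \<Rightarrow> 'a set \<Rightarrow> bool" where
  "uniquely_rooted lt T \<longleftrightarrow> card (tree_level lt T 0) = 1"

definition balanced_tree :: "('a \<Rightarrow> 'a \<Rightarrow> bool) \<Rightarrow> 'a set \<Rightarrow> bool" where
  "balanced_tree lt T \<longleftrightarrow>
     (\<forall>C D. pred_on.maxchain T lt C \<longrightarrow> pred_on.maxchain T lt D \<longrightarrow> C \<approx> D)"

(* b is the branching number. *)
definition homogeneous_tree :: "('a \<Rightarrow> 'a \<Rightarrow> bool) \<Rightarrow> 'a set \<Rightarrow> nat \<Rightarrow> bool" where
  "homogeneous_tree lt T b \<longleftrightarrow>
     tree_on lt T \<and> uniquely_rooted lt T \<and> b \<ge> 2 \<and> (\<forall>t\<in>T. card (imm_succ lt T t) = b)"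

(* Meant for a uniquely rooted tree T. Levels and immediate successors "in S" are
   computed inside S. *)
definition strong_subtree :: "('a \<Rightarrow> 'a \<Rightarrow> bool) \<Rightarrow> 'a set \<Rightarrow> 'a set \<Rightarrow> bool" where
  "strong_subtree lt T S \<longleftrightarrow>
     S \<subseteq> T \<and>
     uniquely_rooted lt S \<and> balanced_tree lt S \<and>
     (\<forall>n. \<exists>m. tree_level lt S n \<subseteq> tree_level lt T m) \<and>
     (\<forall>s\<in>S. (\<exists>u\<in>S. lt s u) \<longrightarrow>
        (\<forall>t\<in>imm_succ lt T s. \<exists>!s'. s' \<in> imm_succ lt S s \<and> lt\<^sup>=\<^sup>= t s'))"

lemma strong_subtree_tree_on:
  assumes "tree_on lt T" "strong_subtree lt T S"
  shows "tree_on lt S"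
proof -
  have sub: "S \<subseteq> T" and "card (tree_level lt S 0) = 1"
    using assms(2) by (auto simp: strong_subtree_def uniquely_rooted_def)
  then have "S \<noteq> {}" by (auto simp: tree_level_def)
  moreover have "irreflp_on S lt" "transp_on S lt"
    using assms(1) sub unfolding tree_on_def
    by (blast intro: irreflp_on_subset transp_on_subset)+
  moreover have "finite {s \<in> S. lt s t} \<and> totalp_on {s \<in> S. lt s t} lt" if "t \<in> S" for t
  proof -
    have "{s \<in> S. lt s t} \<subseteq> {s \<in> T. lt s t}" using sub by auto
    then show ?thesis
      using assms(1) sub that unfolding tree_on_def
      by (meson finite_subset subsetD totalp_on_subset)
  qed
  ultimately show ?thesis by (simp add: tree_on_def)
qed

(* A natural number whenever b > 1 (a geometric sum); kept as a real to avoid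
   truncating subtraction and division. *)
definition p_exponent :: "nat \<Rightarrow> nat \<Rightarrow> real" where
  "p_exponent b k = ((2 ^ b - 1) ^ k - 1) / (2 ^ b - 2)"

end

theory Submission
  imports Defs "HOL-Library.Sublist"
begin

text \<open>
  A homogeneous tree with branching number \<open>b\<close> is the tree of words over \<open>{..<b}\<close>, and its strong
  subtrees of infinite height are the images of \<^emph>\<open>strong embeddings\<close>: maps of words that send levels
  into levels and send the \<open>c\<close>-th successor of \<open>w\<close> above the \<open>c\<close>-th successor of the image of \<open>w\<close>.
  Every strong subtree of height \<open>k\<close> lies in the image of the words of length less than \<open>k\<close> under a
  strong embedding. Two independent arguments give the theorem.

  The first is Ramsey-theoretic. Milliken's theorem for closed families (\<open>milliken_closed\<close>) says: if
  each strong embedding \<open>e\<close> can be thinned to some \<open>e \<circ> g\<close> all of whose initial segments are good,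
  then a single \<open>e\<close> works for all \<open>g\<close> at once. So it is enough to find, inside an arbitrary strong
  subtree, one infinite strong subtree whose initial segments satisfy the bounds. The proof is the
  accept/reject argument of Galvin, Nash-Williams and Ellentuck. Its pigeonhole step, for colourings
  of the tuples of nodes of equal length above the \<open>b ^ m\<close> nodes of level \<open>m\<close>, is the
  Halpern--Laeuchli theorem. Such a tuple is a word over the alphabet of functions from level \<open>m\<close> to
  \<open>{..<b}\<close>, so Halpern--Laeuchli follows from the Carlson--Simpson theorem on variable words, which
  is proved by idempotent ultrafilters on a free monoid.

  The second is measure-theoretic and produces that one subtree level by level. Among many events of
  probability at least \<open>a\<close>, two have an intersection of probability nearly \<open>a\<^sup>2\<close>
  (\<open>second_moment\<close>). Call the intersection of the events at a node and above its first \<open>i\<close> successors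
  a star. Placing many stars of \<open>i\<close> directions along a comb, so that two of them always contain a
  star of \<open>i + 1\<close> directions, doubles the exponent; after \<open>b\<close> doublings the full star at a node has
  probability at least about \<open>a ^ 2 ^ b\<close>. If the probabilities of the events are almost equal to
  \<open>a\<close>, as Milliken's theorem allows one to assume, this says that \<^emph>\<open>conditionally\<close> on the event at
  the root the rest of the star has probability at least about \<open>a ^ (2 ^ b - 1)\<close>
  (\<open>star_conditional_bound\<close>). Conditioning on the levels chosen so far and treating the joint events
  of the next level as a new family on the tree of words, one passes from exponent \<open>q ^ m\<close> at level
  \<open>m\<close> to \<open>q ^ (m + 1)\<close> with \<open>q = 2 ^ b - 1\<close>, whence the total exponent
  \<open>1 + q + \<dots> + q ^ (k - 1)\<close>, which is \<open>p(b, k)\<close> (\<open>strong_emb_initial_segments\<close>). The gap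
  between \<open>\<theta>\<close> and \<open>\<epsilon>\<close> pays for the infinitely many small losses.
\<close>

section \<open>Idempotent ultrafilters on a free monoid\<close>

definition ultra :: "'a filter \<Rightarrow> bool" where
  "ultra F \<longleftrightarrow> F \<noteq> bot \<and> (\<forall>P. eventually P F \<or> eventually (\<lambda>x. \<not> P x) F)"

text \<open>
  The convolution of filters that extends concatenation; on ultrafilters it is the multiplication of
  the Stone--Cech compactification of the free monoid. A filter \<open>F\<close> stands for the closed set of the
  ultrafilters below it. If \<open>F \<odot> F \<le> F\<close>, this set is a subsemigroup, and if \<open>principal W \<odot> F \<le> F\<close>, it
  is closed under multiplication from the left by ultrafilters on \<open>W\<close>. These inequalities replace the
  topology of the compactification.
\<close>
definition fprod :: "'a list filter \<Rightarrow> 'a list filter \<Rightarrow> 'a list filter" (infixl "\<odot>" 70) where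
  "F \<odot> G = Abs_filter (\<lambda>P. eventually (\<lambda>x. eventually (\<lambda>y. P (x @ y)) G) F)"

lemma eventually_fprod:
  "eventually P (F \<odot> G) \<longleftrightarrow> eventually (\<lambda>x. eventually (\<lambda>y. P (x @ y)) G) F"
  unfolding fprod_def
proof (rule eventually_Abs_filter, rule is_filter.intro, goal_cases)
  case 1 then show ?case by simp
next
  case (2 P Q) then show ?case by eventually_elim (rule eventually_conj)
next
  case (3 P Q)
  from 3(2) show ?case
  proof (rule eventually_mono)
    fix x assume "eventually (\<lambda>y. P (x @ y)) G"
    then show "eventually (\<lambda>y. Q (x @ y)) G" by (rule eventually_mono) (use 3(1) in blast)
  qed
qed

lemma fprod_assoc: "(F \<odot> G) \<odot> H = F \<odot> (G \<odot> H)"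
  by (simp add: filter_eq_iff eventually_fprod)

lemma fprod_mono:
  assumes "F \<le> F'" "G \<le> G'" shows "F \<odot> G \<le> F' \<odot> G'"
proof (rule filter_leI)
  fix P assume "eventually P (F' \<odot> G')"
  then have "eventually (\<lambda>x. eventually (\<lambda>y. P (x @ y)) G') F"
    unfolding eventually_fprod using assms(1) by (simp add: filter_leD)
  then show "eventually P (F \<odot> G)"
    unfolding eventually_fprod by eventually_elim (rule filter_leD[OF assms(2)])
qed

lemma fprod_neq_bot: "F \<noteq> bot \<Longrightarrow> G \<noteq> bot \<Longrightarrow> F \<odot> G \<noteq> bot"
  by (simp add: trivial_limit_def eventually_fprod)

lemma fprod_principal:
  assumes "\<And>x y. x \<in> A \<Longrightarrow> y \<in> B \<Longrightarrow> x @ y \<in> C"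
  shows "principal A \<odot> principal B \<le> principal C"
  by (rule filter_leI) (use assms in \<open>auto simp: eventually_fprod eventually_principal\<close>)

lemma ultra_not_eventually:
  "ultra F \<Longrightarrow> \<not> eventually P F \<longleftrightarrow> eventually (\<lambda>x. \<not> P x) F"
  unfolding ultra_def trivial_limit_def using eventually_conj[of P F "\<lambda>x. \<not> P x"] by auto

lemma ultra_fprod: "ultra F \<Longrightarrow> ultra G \<Longrightarrow> ultra (F \<odot> G)"
  unfolding ultra_def[of "F \<odot> G"] eventually_fprod
  by (simp add: ultra_not_eventually[symmetric] fprod_neq_bot ultra_def[of F] ultra_def[of G])

lemma ultra_eqI:
  assumes "ultra q" "F \<le> q" "F \<noteq> bot" shows "F = q"
proof (rule antisym[OF assms(2)], rule filter_leI)
  fix P assume P: "eventually P F"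
  show "eventually P q"
  proof (rule ccontr)
    assume "\<not> eventually P q"
    then have "eventually (\<lambda>x. \<not> P x) F"
      using assms(1,2) by (auto simp: ultra_not_eventually intro: filter_leD)
    with P have "eventually (\<lambda>x. False) F" by eventually_elim simp
    then show False using assms(3) by (simp add: trivial_limit_def)
  qed
qed

lemma ultra_filtermap: "ultra F \<Longrightarrow> ultra (filtermap f F)"
  by (auto simp: ultra_def filtermap_bot_iff eventually_filtermap)

lemma filtermap_fprod:
  assumes "\<And>x y. h (x @ y) = h x @ h y"
  shows "filtermap h (F \<odot> G) = filtermap h F \<odot> filtermap h G"
  by (simp add: filter_eq_iff eventually_fprod eventually_filtermap assms)

text \<open>
  Compactness in filter form: the infimum of a chain of proper filters is proper, so Zorn's lemma gives
  a minimal proper filter with any property that survives infima.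
\<close>
lemma minimal_proper_filter:
  fixes F :: "'a filter"
  assumes "F \<noteq> bot" "Q F"
    and chain: "\<And>C. C \<noteq> {} \<Longrightarrow> \<forall>G\<in>C. Q G \<Longrightarrow> Q (Inf C)"
  obtains G where "G \<le> F" "G \<noteq> bot" "Q G" "\<And>H. H \<le> G \<Longrightarrow> H \<noteq> bot \<Longrightarrow> Q H \<Longrightarrow> H = G"
proof -
  define A where "A = {G. G \<le> F \<and> G \<noteq> bot \<and> Q G}"
  have "\<exists>m\<in>A. \<forall>a\<in>A. m \<ge> a \<longrightarrow> a = m"
  proof (rule predicate_Zorn)
    show "partial_order_on A (relation_of (\<ge>) A)"
      by (rule partial_order_on_relation_ofI) auto
    fix C assume C: "C \<in> Chains (relation_of (\<ge>) A)"
    then have CA: "C \<subseteq> A" by (auto simp: Chains_def relation_of_def)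
    show "\<exists>u\<in>A. \<forall>a\<in>C. a \<ge> u"
    proof (cases "C = {}")
      case True then show ?thesis using assms(1,2) by (auto simp: A_def)
    next
      case False
      have ev: "eventually P (Inf C) \<longleftrightarrow> (\<exists>G\<in>C. eventually P G)" for P
        by (rule eventually_Inf_base[OF False])
          (use C in \<open>force simp: Chains_def relation_of_def\<close>)
      have "Inf C \<in> A"
        using CA False chain[OF False] ev
        by (auto simp: A_def trivial_limit_def subset_iff intro: Inf_lower2)
      then show ?thesis by (auto intro: Inf_lower)
    qed
  qed
  then show ?thesis using that unfolding A_def by (metis (mono_tags, lifting) mem_Collect_eq order_trans)
qed

lemma ultra_below:
  assumes "F \<noteq> bot" obtains U where "U \<le> F" "ultra U"
proof -
  obtain G where G: "G \<le> F" "G \<noteq> bot" "\<And>H. H \<le> G \<Longrightarrow> H \<noteq> bot \<Longrightarrow> H = G"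
    using minimal_proper_filter[of F "\<lambda>_. True"] assms by metis
  have "ultra G" unfolding ultra_def
  proof (intro conjI allI disjCI G(2))
    fix P assume "\<not> eventually (\<lambda>x. \<not> P x) G"
    then have "inf G (principal {x. P x}) \<noteq> bot"
      by (simp add: trivial_limit_def eventually_inf_principal)
    then have "inf G (principal {x. P x}) = G" by (intro G(3)) simp_all
    then have "G \<le> principal {x. P x}" by (metis inf.cobounded2)
    then show "eventually P G" by (simp add: le_principal)
  qed
  then show ?thesis using that G(1) by blast
qed

text \<open>
  The ultrafilters below \<open>F \<odot> p\<close> are products \<open>s \<odot> p\<close> with \<open>s\<close> below \<open>F\<close>. Topologically, the set of
  these products is closed, being the image of a compact set under a right translation, which is
  continuous.
\<close>
lemma ultra_factor:
  assumes "ultra r" "ultra p" "r \<le> F \<odot> p"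
  obtains s where "s \<le> F" "s \<noteq> bot" "s \<odot> p = r"
proof -
  \<comment> \<open>the coarsest filter below \<open>F\<close> with \<open>s \<odot> p \<le> r\<close>\<close>
  define s where "s = Abs_filter (\<lambda>P. \<exists>B. eventually B r \<and>
     eventually (\<lambda>x. eventually (\<lambda>y. B (x @ y)) p \<longrightarrow> P x) F)"
  have ev: "eventually P s \<longleftrightarrow> (\<exists>B. eventually B r \<and>
     eventually (\<lambda>x. eventually (\<lambda>y. B (x @ y)) p \<longrightarrow> P x) F)" for P
    unfolding s_def
  proof (rule eventually_Abs_filter, rule is_filter.intro, goal_cases)
    case 1 then show ?case by (auto intro: exI[of _ "\<lambda>_. True"])
  next
    case (2 P Q)
    then obtain B C where B: "eventually B r" "eventually (\<lambda>x. eventually (\<lambda>y. B (x @ y)) p \<longrightarrow> P x) F"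
      and C: "eventually C r" "eventually (\<lambda>x. eventually (\<lambda>y. C (x @ y)) p \<longrightarrow> Q x) F" by blast
    have "eventually (\<lambda>x. eventually (\<lambda>y. B (x @ y) \<and> C (x @ y)) p \<longrightarrow> P x \<and> Q x) F"
      by (rule eventually_mono[OF eventually_conj[OF B(2) C(2)]]) (simp add: eventually_conj_iff)
    then show ?case using B(1) C(1) by (intro exI[of _ "\<lambda>x. B x \<and> C x"]) (simp add: eventually_conj)
  next
    case (3 P Q)
    from 3(2) obtain B where B: "eventually B r" "eventually (\<lambda>x. eventually (\<lambda>y. B (x @ y)) p \<longrightarrow> P x) F"
      by blast
    have "eventually (\<lambda>x. eventually (\<lambda>y. B (x @ y)) p \<longrightarrow> Q x) F"
      by (rule eventually_mono[OF B(2)]) (use 3(1) in blast)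
    then show ?case using B(1) by blast
  qed
  have "s \<le> F"
  proof (rule filter_leI)
    fix P assume "eventually P F"
    then show "eventually P s" unfolding ev by (intro exI[of _ "\<lambda>_. True"]) simp
  qed
  moreover have nb: "s \<noteq> bot"
  proof
    assume "s = bot"
    then obtain B where B: "eventually B r" "eventually (\<lambda>x. \<not> eventually (\<lambda>y. B (x @ y)) p) F"
      using ev[of "\<lambda>_. False"] by auto
    then have "eventually (\<lambda>x. \<not> B x) (F \<odot> p)"
      by (simp add: eventually_fprod ultra_not_eventually[OF assms(2)])
    then have "eventually (\<lambda>x. \<not> B x) r" by (rule filter_leD[OF assms(3)])
    then show False using B(1) ultra_not_eventually[OF assms(1)] by blast
  qed
  moreover have "s \<odot> p \<le> r"
  proof (rule filter_leI)
    fix B assume "eventually B r"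
    then show "eventually B (s \<odot> p)" unfolding eventually_fprod ev by (intro exI[of _ B]) simp
  qed
  then have "s \<odot> p = r"
    using assms(1,2) nb by (intro ultra_eqI fprod_neq_bot) (auto simp: ultra_def)
  ultimately show ?thesis using that by blast
qed

text \<open>
  The Ellis--Numakura lemma: a compact semigroup contains an idempotent. Take a minimal proper filter
  \<open>F\<close> with \<open>F \<odot> F \<le> F\<close> and an ultrafilter \<open>p\<close> below it. Since \<open>F \<odot> p\<close> has the same property, it equals
  \<open>F\<close>, so some \<open>s\<close> below \<open>F\<close> satisfies \<open>s \<odot> p = p\<close>. The largest filter \<open>q \<le> F\<close> with \<open>q \<odot> p \<le> p\<close>
  then is proper and again has the property, so it is \<open>F\<close>, and \<open>F = F \<odot> p \<le> p\<close> shows \<open>F = p\<close>.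
\<close>
lemma idempotent_ultra_below:
  assumes "G \<noteq> bot" "G \<odot> G \<le> G"
  obtains p where "ultra p" "p \<le> G" "p \<odot> p = p"
proof -
  obtain F where F: "F \<le> G" "F \<noteq> bot" "F \<odot> F \<le> F"
      "\<And>H. H \<le> F \<Longrightarrow> H \<noteq> bot \<Longrightarrow> H \<odot> H \<le> H \<Longrightarrow> H = F"
  proof (rule minimal_proper_filter[of G "\<lambda>F. F \<odot> F \<le> F"])
    fix C :: "'a list filter set" assume "\<forall>G\<in>C. G \<odot> G \<le> G"
    then show "Inf C \<odot> Inf C \<le> Inf C"
      by (meson Inf_greatest Inf_lower fprod_mono order_trans)
  qed (use assms in auto)
  obtain p where p: "p \<le> F" "ultra p" using ultra_below[OF F(2)] by blast
  then have pb: "p \<noteq> bot" by (simp add: ultra_def)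
  have Fp: "F \<odot> p = F"
  proof (rule F(4))
    show "F \<odot> p \<le> F" using fprod_mono[OF order_refl p(1)] F(3) by (rule order_trans)
    have "F \<odot> p \<odot> (F \<odot> p) = F \<odot> (p \<odot> F) \<odot> p" by (simp add: fprod_assoc)
    also have "\<dots> \<le> F \<odot> F \<odot> p"
      using fprod_mono[OF p(1) order_refl[of F]] F(3) by (intro fprod_mono) auto
    also have "\<dots> \<le> F \<odot> p" using F(3) by (intro fprod_mono) auto
    finally show "F \<odot> p \<odot> (F \<odot> p) \<le> F \<odot> p" .
  qed (use F(2) pb in \<open>rule fprod_neq_bot\<close>)
  define K where "K = {s. s \<le> F \<and> s \<odot> p \<le> p}"
  define q where "q = Sup K"
  have evq: "eventually P q \<longleftrightarrow> (\<forall>s\<in>K. eventually P s)" for P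
    by (simp add: q_def eventually_Sup)
  obtain s where "s \<le> F" "s \<noteq> bot" "s \<odot> p = p"
    using ultra_factor[OF p(2) p(2), of F] p(1) Fp by metis
  then have "s \<in> K" "s \<noteq> bot" by (simp_all add: K_def)
  then have qb: "q \<noteq> bot" unfolding q_def by (metis Sup_upper bot.extremum_uniqueI)
  have qF: "q \<le> F" unfolding q_def K_def by (rule Sup_least) simp
  have qp: "q \<odot> p \<le> p"
    by (rule filter_leI) (auto simp: eventually_fprod evq K_def le_filter_def)
  have "q \<odot> q \<in> K" unfolding K_def
  proof safe
    show "q \<odot> q \<le> F" using fprod_mono[OF qF qF] F(3) by (rule order_trans)
    have "q \<odot> (q \<odot> p) \<le> q \<odot> p" using qp by (intro fprod_mono) auto
    then show "q \<odot> q \<odot> p \<le> p" using qp by (simp add: fprod_assoc)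
  qed
  then have "q \<odot> q \<le> q" unfolding q_def by (rule Sup_upper)
  then have "q = F" using F(4) qF qb by blast
  then have "F \<le> p" using qp Fp by simp
  then have "F = p" using p(2) F(2) by (intro ultra_eqI)
  then show ?thesis using that[of p] p F(1) F(3) fprod_neq_bot[OF pb pb] ultra_eqI[OF p(2)]
    by blast
qed

text \<open>
  An idempotent of a minimal left ideal \<open>L\<close> is minimal among idempotents: if \<open>e = e \<odot> p = p \<odot> e\<close>, then
  \<open>e\<close> generates \<open>L\<close>, so \<open>p = s \<odot> e\<close> for some \<open>s\<close>, and hence \<open>p = p \<odot> e = e\<close>.
\<close>
lemma minimal_idempotent:
  assumes "W \<noteq> {}" "\<And>x y. x \<in> W \<Longrightarrow> y \<in> W \<Longrightarrow> x @ y \<in> W"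
  obtains p where "ultra p" "p \<le> principal W" "p \<odot> p = p"
    "\<And>e. ultra e \<Longrightarrow> e \<odot> e = e \<Longrightarrow> e \<le> principal W \<Longrightarrow> e \<odot> p = e \<Longrightarrow> p \<odot> e = e \<Longrightarrow> e = p"
proof -
  let ?W = "principal W"
  have WW: "?W \<odot> ?W \<le> ?W" using assms(2) by (rule fprod_principal)
  obtain L where L: "L \<le> ?W" "L \<noteq> bot" "?W \<odot> L \<le> L"
      "\<And>H. H \<le> L \<Longrightarrow> H \<noteq> bot \<Longrightarrow> ?W \<odot> H \<le> H \<Longrightarrow> H = L"
  proof (rule minimal_proper_filter[of ?W "\<lambda>F. ?W \<odot> F \<le> F"])
    fix C :: "'a list filter set" assume "\<forall>G\<in>C. ?W \<odot> G \<le> G"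
    then show "?W \<odot> Inf C \<le> Inf C"
      by (meson Inf_greatest Inf_lower fprod_mono order_refl order_trans)
  qed (use assms(1) WW in \<open>auto simp: principal_eq_bot_iff\<close>)
  have gen: "?W \<odot> e = L" if "e \<le> L" "e \<noteq> bot" for e
  proof (rule L(4))
    show "?W \<odot> e \<le> L" using fprod_mono[OF order_refl that(1)] L(3) by (rule order_trans)
    show "?W \<odot> e \<noteq> bot" using that(2) assms(1) by (intro fprod_neq_bot) (auto simp: principal_eq_bot_iff)
    have "?W \<odot> ?W \<odot> e \<le> ?W \<odot> e" using WW by (intro fprod_mono) auto
    then show "?W \<odot> (?W \<odot> e) \<le> ?W \<odot> e" by (simp add: fprod_assoc)
  qed
  have "L \<odot> L \<le> L" using fprod_mono[OF L(1) order_refl] L(3) by (rule order_trans)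
  then obtain p where p: "ultra p" "p \<le> L" "p \<odot> p = p"
    using idempotent_ultra_below L(2) by blast
  have "e = p" if e: "ultra e" "e \<odot> e = e" "e \<le> ?W" "e \<odot> p = e" "p \<odot> e = e" for e
  proof -
    have "e = e \<odot> p" using e by simp
    also have "\<dots> \<le> ?W \<odot> L" using e p by (intro fprod_mono) auto
    also have "\<dots> \<le> L" by (rule L)
    finally have "?W \<odot> e = L" using e(1) by (intro gen) (auto simp: ultra_def)
    then obtain s where "s \<odot> e = p" using ultra_factor[OF p(1) e(1)] p(2) by metis
    then have "p \<odot> e = p" using e(2) by (metis fprod_assoc)
    then show ?thesis using e(5) by simp
  qed
  then show ?thesis using that p L(1) by (metis order_trans)
qed

section \<open>The Carlson--Simpson theorem\<close>

text \<open>
  A list over \<open>'c option\<close> is a variable word, in which \<open>None\<close> is the variable.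
\<close>
definition plug :: "'c \<Rightarrow> 'c option list \<Rightarrow> 'c list" where
  "plug a t = map (case_option a id) t"

text \<open>
  The Carlson--Simpson tree with stem \<open>x\<close>: after each letter of \<open>y\<close>, the next word of \<open>t\<close> follows with
  that letter in place of its variable. The explicit letter in front of it makes the variable words
  left-variable, and this is what turns such trees into strong subtrees.
\<close>
definition cs_word :: "'c list \<Rightarrow> (nat \<Rightarrow> 'c option list) \<Rightarrow> 'c list \<Rightarrow> 'c list" where
  "cs_word x t y = x @ concat (map (\<lambda>j. y ! j # plug (y ! j) (t j)) [0..<length y])"

lemma plug_append: "plug a (s @ t) = plug a s @ plug a t"
  by (simp add: plug_def)

lemma plug_map_Some [simp]: "plug a (map Some w) = w"
  by (induction w) (simp_all add: plug_def)

lemma cs_word_Nil [simp]: "cs_word x t [] = x"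
  by (simp add: cs_word_def)

lemma cs_word_snoc: "cs_word x t (y @ [a]) = cs_word x t y @ a # plug a (t (length y))"
proof -
  have "map (\<lambda>j. (y @ [a]) ! j # plug ((y @ [a]) ! j) (t j)) [0..<length y]
      = map (\<lambda>j. y ! j # plug (y ! j) (t j)) [0..<length y]"
    by (rule map_cong[OF refl]) (simp add: nth_append)
  then show ?thesis by (simp add: cs_word_def del: map_eq_conv)
qed

text \<open>
  Coordinatewise letter maps send Carlson--Simpson trees to Carlson--Simpson trees. With letters that
  are themselves tuples, this yields one strong subtree in each coordinate.
\<close>
lemma map_cs_word:
  "map \<pi> (cs_word x t y) = cs_word (map \<pi> x) (\<lambda>j. map (map_option \<pi>) (t j)) (map \<pi> y)"
proof (induction y rule: rev_induct)
  case (snoc a y)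
  have "map \<pi> (plug a s) = plug (\<pi> a) (map (map_option \<pi>) s)" for s
    by (auto simp: plug_def split: option.splits)
  with snoc show ?case by (simp add: cs_word_snoc)
qed simp

lemma length_cs_word:
  "length (cs_word x t y) = length x + (\<Sum>j<length y. Suc (length (t j)))"
  by (induction y rule: rev_induct) (simp_all add: cs_word_snoc plug_def)

lemma cs_word_in_lists:
  assumes "x \<in> lists A" "\<And>j. t j \<in> lists (insert None (Some ` A))" "y \<in> lists A"
  shows "cs_word x t y \<in> lists A"
  using assms(3)
proof (induction y rule: rev_induct)
  case (snoc a y)
  then have "plug a s \<in> lists A" if "s \<in> lists (insert None (Some ` A))" for s
    using that by (induction s) (auto simp: plug_def)
  with snoc assms(2) show ?case by (simp add: cs_word_snoc)
qed (simp add: assms(1))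

text \<open>
  Let \<open>p\<close> be a minimal idempotent on the words without variable and \<open>q\<close> an idempotent below \<open>p\<close> on the
  words with a variable. Putting a letter in place of the variable is a homomorphism that fixes \<open>p\<close>, so
  it sends \<open>q\<close> to an idempotent below \<open>p\<close>, which by minimality is \<open>p\<close> itself, whatever the letter. Hence
  \<open>q\<close>-typical variable words extend a \<open>p\<close>-typical word to \<open>p\<close>-typical words for all letters at once.
  The colour that occurs is decided by \<open>p\<close> followed by the typical part of a variable word before its
  first variable, since a node of the tree ends right before a variable.
\<close>
theorem carlson_simpson:
  fixes C :: "'c list set"
  assumes fin: "finite \<Lambda>"
  obtains x t where "x \<in> lists \<Lambda>" "\<And>j. t j \<in> lists (insert None (Some ` \<Lambda>))"
    "(\<forall>y\<in>lists \<Lambda>. cs_word x t y \<in> C) \<or> (\<forall>y\<in>lists \<Lambda>. cs_word x t y \<notin> C)"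
proof -
  define W where "W = map Some ` lists \<Lambda>"
  define V where "V = {w \<in> lists (insert None (Some ` \<Lambda>)). None \<in> set w}"
  define \<sigma> where "\<sigma> a w = map Some (plug a w)" for a and w :: "'c option list"
  define pre where "pre w = takeWhile (\<lambda>z. z \<noteq> None) w" for w :: "'c option list"
  define suf where "suf w = tl (dropWhile (\<lambda>z. z \<noteq> None) w)" for w :: "'c option list"
  have \<sigma>_append: "\<sigma> a (u @ v) = \<sigma> a u @ \<sigma> a v" for a u v
    by (simp add: \<sigma>_def plug_append)
  have \<sigma>_W: "\<sigma> a w = w" if "w \<in> W" for a w
    using that by (auto simp: W_def \<sigma>_def)
  have W_lists: "W = lists (Some ` \<Lambda>)"
    by (simp add: W_def lists_image)
  have \<sigma>_V: "\<sigma> a w \<in> W" if "w \<in> V" "a \<in> \<Lambda>" for a w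
  proof -
    have "plug a w \<in> lists \<Lambda>"
      using that by (auto simp: V_def plug_def lists_eq_set split: option.splits)
    then show ?thesis by (simp add: W_def \<sigma>_def)
  qed
  have split: "w = pre w @ None # suf w" if "w \<in> V" for w
  proof -
    have "dropWhile (\<lambda>z. z \<noteq> None) w \<noteq> []" using that by (auto simp: V_def dropWhile_eq_Nil_conv)
    moreover from hd_dropWhile[OF this] have "hd (dropWhile (\<lambda>z. z \<noteq> None) w) = None" by simp
    ultimately have "dropWhile (\<lambda>z. z \<noteq> None) w = None # suf w" unfolding suf_def by (metis list.collapse)
    then show ?thesis unfolding pre_def by (metis takeWhile_dropWhile_id)
  qed
  have pre_W: "pre w \<in> W" if "w \<in> V" for w
    using that unfolding W_lists lists_eq_set V_def pre_def by (auto dest: set_takeWhileD)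
  have suf_lists: "suf w \<in> lists (insert None (Some ` \<Lambda>))" if "w \<in> V" for w
  proof -
    have "pre w @ None # suf w \<in> lists (insert None (Some ` \<Lambda>))"
      using that unfolding split[OF that, symmetric] by (simp add: V_def)
    then show ?thesis by simp
  qed
  have Nil_W: "[] \<in> W" by (simp add: W_def)
  have app_W: "u @ v \<in> W" if "u \<in> W" "v \<in> W" for u v
    using that by (simp add: W_lists)
  obtain p where p: "ultra p" "p \<le> principal W" "p \<odot> p = p"
    and min: "\<And>e. ultra e \<Longrightarrow> e \<odot> e = e \<Longrightarrow> e \<le> principal W \<Longrightarrow> e \<odot> p = e \<Longrightarrow> p \<odot> e = e \<Longrightarrow> e = p"
    using minimal_idempotent[of W] app_W Nil_W by blast
  have p_nb: "p \<noteq> bot" using p(1) by (simp add: ultra_def)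
  have VWV: "principal V \<odot> p \<odot> principal V \<le> principal V"
  proof -
    have "principal V \<odot> p \<odot> principal V \<le> principal V \<odot> principal W \<odot> principal V"
      using p(2) by (intro fprod_mono order_refl)
    also have "\<dots> \<le> principal V \<odot> principal V"
      by (intro fprod_mono fprod_principal) (auto simp: V_def W_lists subset_iff)
    also have "\<dots> \<le> principal V" by (rule fprod_principal) (auto simp: V_def)
    finally show ?thesis .
  qed
  have "principal V \<noteq> bot"
    by (auto simp: principal_eq_bot_iff V_def intro!: exI[of _ "[None]"])
  then obtain r where r: "ultra r" "r \<le> principal V \<odot> p" "r \<odot> r = r"
    using idempotent_ultra_below[of "principal V \<odot> p"] fprod_mono[OF VWV order_refl, of p] p_nb
    by (metis fprod_assoc fprod_neq_bot)
  obtain s where s: "s \<odot> p = r"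
    using ultra_factor[OF r(1) p(1) r(2)] by blast
  then have rp: "r \<odot> p = r" using p(3) by (metis fprod_assoc)
  \<comment> \<open>an idempotent of the two-sided ideal of variable words with \<open>q \<odot> p = q = p \<odot> q\<close>\<close>
  define q where "q = p \<odot> r"
  have q: "ultra q" using p(1) r(1) by (simp add: q_def ultra_fprod)
  have qq: "q \<odot> q = q" "p \<odot> q = q" "q \<odot> p = q"
    using p(3) r(3) rp unfolding q_def by (metis fprod_assoc)+
  have qV: "q \<le> principal V"
  proof -
    have "q \<le> principal W \<odot> (principal V \<odot> principal W)"
      unfolding q_def using p(2) fprod_mono[OF order_refl p(2)] r(2)
      by (intro fprod_mono) (blast intro: order_trans)+
    also have "\<dots> \<le> principal W \<odot> principal V"
      by (intro fprod_mono fprod_principal) (auto simp: V_def W_lists subset_iff)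
    also have "\<dots> \<le> principal V" by (rule fprod_principal) (auto simp: V_def W_lists subset_iff)
    finally show ?thesis .
  qed
  then have evV: "eventually (\<lambda>w. w \<in> V) q" by (simp add: le_principal)
  have \<sigma>p: "filtermap (\<sigma> a) p = p" for a
  proof (rule filter_eq_iff[THEN iffD2], intro allI)
    fix P
    have W: "eventually (\<lambda>w. w \<in> W) p" using p(2) by (simp add: le_principal)
    show "eventually P (filtermap (\<sigma> a) p) = eventually P p"
      unfolding eventually_filtermap
      by (rule eventually_cong[OF W]) (simp add: \<sigma>_W)
  qed
  have \<sigma>q: "filtermap (\<sigma> a) q = p" if "a \<in> \<Lambda>" for a
  proof (rule min)
    show "filtermap (\<sigma> a) q \<le> principal W"
      unfolding le_principal eventually_filtermap
      by (rule eventually_mono[OF evV]) (use \<sigma>_V that in blast)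
    show "filtermap (\<sigma> a) q \<odot> p = filtermap (\<sigma> a) q"
      using filtermap_fprod[of "\<sigma> a" q p, OF \<sigma>_append] by (simp add: \<sigma>p qq)
    show "p \<odot> filtermap (\<sigma> a) q = filtermap (\<sigma> a) q"
      using filtermap_fprod[of "\<sigma> a" p q, OF \<sigma>_append] by (simp add: \<sigma>p qq)
    show "filtermap (\<sigma> a) q \<odot> filtermap (\<sigma> a) q = filtermap (\<sigma> a) q"
      using filtermap_fprod[of "\<sigma> a" q q, OF \<sigma>_append] by (simp add: qq)
  qed (rule ultra_filtermap[OF q])
  define rp where "rp = filtermap pre q"
  have main: "\<exists>x t. x \<in> lists \<Lambda> \<and> (\<forall>j. t j \<in> lists (insert None (Some ` \<Lambda>))) \<and>
      (\<forall>y\<in>lists \<Lambda>. D (cs_word x t y))"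
    if D: "eventually (\<lambda>w. D (map the w)) (p \<odot> rp)" for D
  proof -
    \<comment> \<open>Words of \<open>C1\<close> get the right colour when the part of a typical variable word before its first
      variable is appended. Words of \<open>C2\<close> moreover stay in \<open>C1\<close> when typical words are appended;
      idempotence of \<open>p\<close> lets them even stay in \<open>C2\<close>.\<close>
    define C1 where "C1 w \<longleftrightarrow> eventually (\<lambda>x. D (map the (w @ x))) rp" for w
    define C2 where "C2 w \<longleftrightarrow> w \<in> W \<and> C1 w \<and> eventually (\<lambda>u. C1 (w @ u)) p" for w
    have "eventually C1 p" using D by (simp add: eventually_fprod C1_def[abs_def])
    moreover from this have "eventually (\<lambda>w. eventually (\<lambda>u. C1 (w @ u)) p) p"
      by (subst (asm) p(3)[symmetric]) (simp add: eventually_fprod)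
    moreover have W: "eventually (\<lambda>w. w \<in> W) p" using p(2) by (simp add: le_principal)
    ultimately have "eventually C2 p" by (simp add: C2_def[abs_def] eventually_conj_iff)
    then obtain w0 where w0: "C2 w0" using p_nb eventually_happens by blast
    have next_C2: "eventually (\<lambda>u. C2 (w @ u)) p" if "C2 w" for w
    proof -
      have 1: "eventually (\<lambda>u. C1 (w @ u)) p" using that by (simp add: C2_def)
      then have "eventually (\<lambda>u. C1 (w @ u)) (p \<odot> p)" by (simp add: p(3))
      then have 2: "eventually (\<lambda>u. eventually (\<lambda>u'. C1 (w @ u @ u')) p) p"
        by (simp add: eventually_fprod)
      show ?thesis
        by (rule eventually_mono[OF eventually_conj[OF W eventually_conj[OF 1 2]]])
          (use that in \<open>simp add: C2_def app_W\<close>)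
    qed
    have step: "\<exists>w\<in>V. \<forall>y\<in>Y. D (map the (y @ pre w)) \<and> (\<forall>a\<in>\<Lambda>. C2 (y @ \<sigma> a w))"
      if "finite Y" "\<forall>y\<in>Y. C2 y" for Y
    proof -
      have "eventually (\<lambda>w. C2 (y @ \<sigma> a w)) q" if "y \<in> Y" "a \<in> \<Lambda>" for y a
      proof -
        have "eventually (\<lambda>u. C2 (y @ u)) (filtermap (\<sigma> a) q)"
          unfolding \<sigma>q[OF that(2)] using \<open>\<forall>y\<in>Y. C2 y\<close> that(1) by (intro next_C2) blast
        then show ?thesis by (simp add: eventually_filtermap)
      qed
      moreover have "eventually (\<lambda>w. D (map the (y @ pre w))) q" if "y \<in> Y" for y
        using that \<open>\<forall>y\<in>Y. C2 y\<close> by (simp add: C2_def C1_def rp_def eventually_filtermap)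
      ultimately have "eventually (\<lambda>w. w \<in> V \<and> (\<forall>y\<in>Y. D (map the (y @ pre w)) \<and> (\<forall>a\<in>\<Lambda>. C2 (y @ \<sigma> a w)))) q"
        using evV \<open>finite Y\<close> fin by (simp add: eventually_conj_iff eventually_ball_finite_distrib)
      moreover have "q \<noteq> bot" using q by (simp add: ultra_def)
      ultimately have "\<exists>w. w \<in> V \<and> (\<forall>y\<in>Y. D (map the (y @ pre w)) \<and> (\<forall>a\<in>\<Lambda>. C2 (y @ \<sigma> a w)))"
        using eventually_happens' by blast
      then show ?thesis by blast
    qed
    define pick where "pick Y = (SOME w. w \<in> V \<and> (\<forall>y\<in>Y. D (map the (y @ pre w)) \<and> (\<forall>a\<in>\<Lambda>. C2 (y @ \<sigma> a w))))" for Y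
    have pick: "pick Y \<in> V" "\<forall>y\<in>Y. D (map the (y @ pre (pick Y))) \<and> (\<forall>a\<in>\<Lambda>. C2 (y @ \<sigma> a (pick Y)))"
      if "finite Y" "\<forall>y\<in>Y. C2 y" for Y
      using someI_ex[OF step[OF that, unfolded Bex_def]] unfolding pick_def by blast+
    \<comment> \<open>the finitely many instances of the first \<open>n\<close> variable words, over all letters\<close>
    define Y where "Y = rec_nat {w0} (\<lambda>_ Y. (\<lambda>(y, a). y @ \<sigma> a (pick Y)) ` (Y \<times> \<Lambda>))"
    have Y_Suc: "Y (Suc n) = (\<lambda>(y, a). y @ \<sigma> a (pick (Y n))) ` (Y n \<times> \<Lambda>)" for n
      by (simp add: Y_def)
    have Y: "finite (Y n) \<and> (\<forall>y\<in>Y n. C2 y)" for n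
    proof (induction n)
      case 0 then show ?case using w0 by (simp add: Y_def)
    next
      case (Suc n)
      then show ?case using pick(2)[of "Y n"] fin by (auto simp: Y_Suc)
    qed
    define ws where "ws n = pick (Y n)" for n
    have wsV: "ws n \<in> V" for n using pick(1) Y by (simp add: ws_def)
    define t where "t j = suf (ws j) @ pre (ws (Suc j))" for j
    define x where "x = map the (w0 @ pre (ws 0))"
    have Some_the: "map Some (map the w) = w" if "w \<in> W" for w
      using that by (auto simp: W_def)
    have \<sigma>ws: "\<sigma> a (ws n) = pre (ws n) @ Some a # \<sigma> a (suf (ws n))" for a n
      using \<sigma>_append[of a "pre (ws n)" "None # suf (ws n)"] split[OF wsV[of n]] \<sigma>_W[OF pre_W[OF wsV]]
      by (simp add: \<sigma>_def plug_def)
    have key: "\<exists>B\<in>Y (length y). map Some (cs_word x t y) = B @ pre (ws (length y))" if "y \<in> lists \<Lambda>" for y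
      using that
    proof (induction y rule: rev_induct)
      case Nil
      have "w0 @ pre (ws 0) \<in> W" using w0 pre_W[OF wsV] by (simp add: app_W C2_def)
      from Some_the[OF this] show ?case by (simp add: Y_def x_def)
    next
      case (snoc a y)
      then obtain B where B: "B \<in> Y (length y)" "map Some (cs_word x t y) = B @ pre (ws (length y))" by auto
      have "a \<in> \<Lambda>" using snoc.prems by simp
      then have "B @ \<sigma> a (ws (length y)) \<in> Y (length (y @ [a]))"
        using B(1) by (auto simp: Y_Suc ws_def)
      moreover have "\<sigma> a (pre (ws (Suc (length y)))) = pre (ws (Suc (length y)))"
        by (rule \<sigma>_W[OF pre_W[OF wsV]])
      then have "map Some (cs_word x t (y @ [a])) = (B @ \<sigma> a (ws (length y))) @ pre (ws (length (y @ [a])))"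
        using B(2) \<sigma>_append[of a "suf (ws (length y))" "pre (ws (Suc (length y)))"]
        by (simp add: cs_word_snoc t_def \<sigma>ws) (simp add: \<sigma>_def)
      ultimately show ?case by blast
    qed
    have "D (cs_word x t y)" if "y \<in> lists \<Lambda>" for y
    proof -
      obtain B where B: "B \<in> Y (length y)" "map Some (cs_word x t y) = B @ pre (ws (length y))"
        using key \<open>y \<in> lists \<Lambda>\<close> by blast
      have "D (map the (map Some (cs_word x t y)))"
        unfolding B(2) ws_def using pick(2)[of "Y (length y)"] Y B(1) by blast
      then show ?thesis by (simp add: comp_def)
    qed
    moreover have "x \<in> lists \<Lambda>"
    proof -
      have "w0 @ pre (ws 0) \<in> W" using w0 pre_W[OF wsV] by (simp add: app_W C2_def)
      then show ?thesis unfolding x_def W_lists by (auto simp: lists_eq_set)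
    qed
    moreover have "t j \<in> lists (insert None (Some ` \<Lambda>))" for j
      using suf_lists[OF wsV] pre_W[OF wsV] unfolding t_def W_lists by (auto simp: lists_eq_set)
    ultimately show ?thesis by blast
  qed
  have "ultra (p \<odot> rp)" unfolding rp_def by (intro ultra_fprod ultra_filtermap p(1) q)
  then consider "eventually (\<lambda>w. map the w \<in> C) (p \<odot> rp)" | "eventually (\<lambda>w. map the w \<notin> C) (p \<odot> rp)"
    unfolding ultra_def by blast
  then have "\<exists>x t. x \<in> lists \<Lambda> \<and> (\<forall>j. t j \<in> lists (insert None (Some ` \<Lambda>))) \<and>
      ((\<forall>y\<in>lists \<Lambda>. cs_word x t y \<in> C) \<or> (\<forall>y\<in>lists \<Lambda>. cs_word x t y \<notin> C))"
  proof cases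
    case 1
    from main[OF this] show ?thesis by blast
  next
    case 2
    from main[OF this] show ?thesis by blast
  qed
  then show thesis using that by blast
qed

section \<open>Strong embeddings of the tree of words\<close>

definition words :: "nat \<Rightarrow> nat list set" where
  "words b = lists {..<b}"

definition words_of_length :: "nat \<Rightarrow> nat \<Rightarrow> nat list set" where
  "words_of_length b n = {w \<in> words b. length w = n}"

lemma Nil_in_words [simp]: "[] \<in> words b"
  and words_append_iff [simp]: "u @ v \<in> words b \<longleftrightarrow> u \<in> words b \<and> v \<in> words b"
  and words_Cons_iff [simp]: "c # v \<in> words b \<longleftrightarrow> c < b \<and> v \<in> words b"
  by (auto simp: words_def)

lemma take_in_words: "w \<in> words b \<Longrightarrow> take n w \<in> words b"
  and drop_in_words: "w \<in> words b \<Longrightarrow> drop n w \<in> words b"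
  by (auto simp: words_def dest: in_set_takeD in_set_dropD)

lemma finite_words_of_length: "finite (words_of_length b n)"
proof -
  have "words_of_length b n = {w. set w \<subseteq> {..<b} \<and> length w = n}"
    by (auto simp: words_of_length_def words_def lists_eq_set)
  then show ?thesis by (simp add: finite_lists_length_eq)
qed

lemma finite_words_below: "finite {w \<in> words b. length w < k}"
proof -
  have "{w \<in> words b. length w < k} = (\<Union>i<k. words_of_length b i)" by (auto simp: words_of_length_def)
  then show ?thesis by (simp add: finite_words_of_length)
qed

lemma words_of_length_nonempty: "0 < b \<Longrightarrow> words_of_length b n \<noteq> {}"
  by (auto simp: words_of_length_def words_def intro!: exI[of _ "replicate n 0"])

text \<open>
  The set \<open>strong_emb b m\<close> consists of the strong embeddings of the tree of words that fix all words of
  length less than \<open>m\<close>; in the notation of Ramsey spaces it is the basic set \<open>[m, id]\<close>. Every such set is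
  closed under composition, and the elements of \<open>strong_emb b m\<close> serve as thinnings beyond level \<open>m\<close>. Lists with
  letters outside the alphabet are fixed, so that embeddings are determined by their values on words.
\<close>
definition strong_emb :: "nat \<Rightarrow> nat \<Rightarrow> (nat list \<Rightarrow> nat list) set" where
  "strong_emb b m = {e.
     (\<forall>w. w \<notin> words b \<longrightarrow> e w = w) \<and>
     (\<forall>w\<in>words b. e w \<in> words b) \<and>
     (\<forall>u\<in>words b. \<forall>w\<in>words b. length u = length w \<longrightarrow> length (e u) = length (e w)) \<and>
     (\<forall>w\<in>words b. \<forall>c<b. prefix (e w @ [c]) (e (w @ [c]))) \<and>
     (\<forall>w\<in>words b. length w < m \<longrightarrow> e w = w)}"

lemma strong_embI:
  assumes "\<And>w. w \<notin> words b \<Longrightarrow> e w = w"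
    and "\<And>w. w \<in> words b \<Longrightarrow> e w \<in> words b"
    and "\<And>u w. u \<in> words b \<Longrightarrow> w \<in> words b \<Longrightarrow> length u = length w \<Longrightarrow> length (e u) = length (e w)"
    and "\<And>w c. w \<in> words b \<Longrightarrow> c < b \<Longrightarrow> prefix (e w @ [c]) (e (w @ [c]))"
    and "\<And>w. w \<in> words b \<Longrightarrow> length w < m \<Longrightarrow> e w = w"
  shows "e \<in> strong_emb b m"
  unfolding strong_emb_def using assms by blast

lemma strong_embD:
  assumes "e \<in> strong_emb b m"
  shows strong_emb_outside: "\<And>w. w \<notin> words b \<Longrightarrow> e w = w"
    and strong_emb_words: "\<And>w. w \<in> words b \<Longrightarrow> e w \<in> words b"
    and strong_emb_length_eq: "\<And>u w. u \<in> words b \<Longrightarrow> w \<in> words b \<Longrightarrow> length u = length w \<Longrightarrow> length (e u) = length (e w)"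
    and strong_emb_succ: "\<And>w c. w \<in> words b \<Longrightarrow> c < b \<Longrightarrow> prefix (e w @ [c]) (e (w @ [c]))"
    and strong_emb_fixed: "\<And>w. w \<in> words b \<Longrightarrow> length w < m \<Longrightarrow> e w = w"
  using assms unfolding strong_emb_def by blast+

lemma strong_emb_antimono: "m \<le> n \<Longrightarrow> strong_emb b n \<subseteq> strong_emb b m"
  unfolding strong_emb_def by fastforce

lemma strong_emb_0: "e \<in> strong_emb b m \<Longrightarrow> e \<in> strong_emb b 0"
  using strong_emb_antimono[of 0 m b] by blast

lemma id_strong_emb [simp]: "id \<in> strong_emb b m"
  by (rule strong_embI) auto

lemma strong_emb_prefix:
  assumes e: "e \<in> strong_emb b m" and uv: "u \<in> words b" "c < b" "v \<in> words b"
  shows "prefix (e u @ [c]) (e (u @ c # v))"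
  using uv(3)
proof (induction v rule: rev_induct)
  case Nil then show ?case using strong_emb_succ[OF e uv(1,2)] by simp
next
  case (snoc d v)
  have "prefix (e (u @ c # v) @ [d]) (e ((u @ c # v) @ [d]))"
    using snoc uv by (intro strong_emb_succ[OF e]) simp_all
  with snoc show ?case by simp (metis append_prefixD prefix_order.trans)
qed

lemma strong_emb_prefix_mono:
  assumes "e \<in> strong_emb b m" "u @ v \<in> words b"
  shows "prefix (e u) (e (u @ v))"
proof (cases v)
  case (Cons c v')
  then show ?thesis using strong_emb_prefix[OF assms(1), of u c v'] assms(2) append_prefixD by auto
qed simp

lemma strong_emb_comp [intro]:
  assumes e: "e \<in> strong_emb b m" and d: "d \<in> strong_emb b m"
  shows "e \<circ> d \<in> strong_emb b m"
proof (rule strong_embI)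
  fix w c assume w: "w \<in> words b" "c < (b::nat)"
  obtain v where v: "d (w @ [c]) = d w @ c # v"
    using strong_emb_succ[OF d w] by (auto simp: prefix_def)
  have "d (w @ [c]) \<in> words b" using w by (intro strong_emb_words[OF d]) simp
  then show "prefix ((e \<circ> d) w @ [c]) ((e \<circ> d) (w @ [c]))"
    using strong_emb_prefix[OF e strong_emb_words[OF d w(1)] w(2), of v] by (simp add: v)
next
  fix u w assume "u \<in> words b" "w \<in> words b" "length u = length w"
  then show "length ((e \<circ> d) u) = length ((e \<circ> d) w)"
    using strong_emb_length_eq[OF e, of "d u" "d w"] strong_emb_length_eq[OF d, of u w]
    by (simp add: strong_emb_words[OF d])
qed (use strong_emb_outside[OF e] strong_emb_outside[OF d] strong_emb_words[OF e] strong_emb_words[OF d]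
    strong_emb_fixed[OF e] strong_emb_fixed[OF d] in auto)

lemma strong_emb_length_less:
  assumes e: "e \<in> strong_emb b m" and uw: "u \<in> words b" "w \<in> words b" "length u < length w"
  shows "length (e u) < length (e w)"
proof -
  obtain c v where cv: "drop (length u) w = c # v"
    using uw(3) by (metis Cons_nth_drop_Suc)
  have w: "w = take (length u) w @ c # v" by (simp flip: cv)
  then have *: "take (length u) w \<in> words b" "c < b" "v \<in> words b" using uw(2) by (metis words_append_iff words_Cons_iff)+
  have "length (e u) = length (e (take (length u) w))"
    using uw * by (intro strong_emb_length_eq[OF e]) auto
  also have "\<dots> < length (e w)"
    using prefix_length_le[OF strong_emb_prefix[OF e *]] w by simp
  finally show ?thesis .
qed

lemma strong_emb_length_ge:
  assumes "e \<in> strong_emb b m" "w \<in> words b"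
  shows "length w \<le> length (e w)"
  using assms(2)
proof (induction w rule: rev_induct)
  case (snoc c w)
  then show ?case using strong_emb_length_less[OF assms(1), of w "w @ [c]"] by auto
qed simp

lemma strong_emb_inj:
  assumes e: "e \<in> strong_emb b m"
  shows "u \<in> words b \<Longrightarrow> w \<in> words b \<Longrightarrow> length u = length w \<Longrightarrow> e u = e w \<Longrightarrow> u = w"
proof (induction u arbitrary: w rule: rev_induct)
  case (snoc c u)
  then obtain d w' where w: "w = w' @ [d]" by (cases w rule: rev_cases) auto
  have "prefix (e u @ [c]) (e w)" "prefix (e w' @ [d]) (e w)"
    using snoc.prems strong_emb_succ[OF e, of u c] strong_emb_succ[OF e, of w' d] by (auto simp: w)
  moreover have "length (e u) = length (e w')"
    using snoc.prems w by (intro strong_emb_length_eq[OF e]) auto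
  ultimately have "e u @ [c] = e w' @ [d]"
    using prefix_same_cases[of "e u @ [c]" "e w" "e w' @ [d]"] by (auto dest!: prefix_length_prefix simp: prefix_def)
  then show ?case using snoc.IH[of w'] snoc.prems w by auto
qed simp

text \<open>
  Fixing the levels below \<open>m\<close> keeps every word above its prefix of length \<open>m\<close>, although words of length
  \<open>m\<close> themselves may move.
\<close>
lemma strong_emb_fixed_prefix:
  assumes e: "e \<in> strong_emb b m" and w: "w \<in> words b" "length v = m" "prefix v w"
  shows "prefix v (e w)"
proof (cases v rule: rev_cases)
  case (snoc u c)
  obtain z where z: "w = u @ c # z" using w(3) snoc by (auto simp: prefix_def)
  then have "prefix (e u @ [c]) (e w)" using strong_emb_prefix[OF e, of u c z] w(1) by simp
  moreover have "e u = u" using w z snoc by (intro strong_emb_fixed[OF e]) auto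
  ultimately show ?thesis using snoc by simp
qed simp

text \<open>
  Agrees with \<open>g\<close> up to level \<open>m\<close> and appends letters unchanged beyond it. So it records only the tree
  spanned by the first \<open>m\<close> levels of \<open>g\<close> and the roots of the cones in which \<open>g\<close> continues.
\<close>
definition tail_shift :: "nat \<Rightarrow> nat \<Rightarrow> (nat list \<Rightarrow> nat list) \<Rightarrow> nat list \<Rightarrow> nat list" where
  "tail_shift b m g w = (if w \<in> words b \<and> m \<le> length w then g (take m w) @ drop m w else g w)"

lemma tail_shift_append [simp]:
  "v \<in> words b \<Longrightarrow> w \<in> words b \<Longrightarrow> length v = m \<Longrightarrow> tail_shift b m g (v @ w) = g v @ w"
  by (simp add: tail_shift_def)

lemma tail_shift_strong_emb:
  assumes g: "g \<in> strong_emb b n"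
  shows "tail_shift b m g \<in> strong_emb b (min m n)"
proof (rule strong_embI)
  fix w c assume w: "w \<in> words b" "c < (b::nat)"
  show "prefix (tail_shift b m g w @ [c]) (tail_shift b m g (w @ [c]))"
    using strong_emb_succ[OF g w] w by (cases "m \<le> length w") (auto simp: tail_shift_def)
next
  fix u w assume "u \<in> words b" "w \<in> words b" "length u = length w"
  then show "length (tail_shift b m g u) = length (tail_shift b m g w)"
    using strong_emb_length_eq[OF g, of "take m u" "take m w"] strong_emb_length_eq[OF g, of u w]
    by (simp add: tail_shift_def take_in_words)
qed (use strong_emb_outside[OF g] strong_emb_words[OF g] strong_emb_fixed[OF g] in \<open>auto simp: tail_shift_def take_in_words drop_in_words\<close>)

text \<open>
  Every \<open>g\<close> is a thinning of its \<open>tail_shift\<close>, and the thinning even fixes the words of length \<open>m\<close>, since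
  the two maps agree on them.
\<close>
lemma tail_shift_factor:
  assumes g: "g \<in> strong_emb b n"
  obtains d where "d \<in> strong_emb b (Suc m)" "g = tail_shift b m g \<circ> d"
proof -
  define d where "d w = (if w \<in> words b \<and> m \<le> length w
    then take m w @ drop (length (g (take m w))) (g w) else w)" for w
  have pre: "prefix (g (take m w)) (g w)" if "w \<in> words b" for w
    using strong_emb_prefix_mono[OF g, of "take m w" "drop m w"] that by simp
  have "d \<in> strong_emb b (Suc m)"
  proof (rule strong_embI)
    fix w c assume w: "w \<in> words b" "c < (b::nat)"
    show "prefix (d w @ [c]) (d (w @ [c]))"
    proof (cases "m \<le> length w")
      case True
      obtain x where x: "g w = g (take m w) @ x" using pre[OF w(1)] by (auto simp: prefix_def)
      obtain y where "g (w @ [c]) = g w @ c # y" using strong_emb_succ[OF g w] by (auto simp: prefix_def)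
      then show ?thesis using x w True by (simp add: d_def)
    next
      case False
      then show ?thesis using w by (cases "Suc (length w) = m") (simp_all add: d_def)
    qed
  next
    fix u w assume *: "u \<in> words b" "w \<in> words b" "length u = length w"
    then have "length (g (take m u)) = length (g (take m w))" "length (g u) = length (g w)"
      by (auto intro!: strong_emb_length_eq[OF g] simp: take_in_words)
    then show "length (d u) = length (d w)" using * by (simp add: d_def)
  qed (use strong_emb_outside[OF g] strong_emb_words[OF g] in \<open>auto simp: d_def take_in_words drop_in_words\<close>)
  moreover have "g w = (tail_shift b m g \<circ> d) w" for w
  proof (cases "w \<in> words b \<and> m \<le> length w")
    case True
    then obtain x where x: "g w = g (take m w) @ x" using pre by (auto simp: prefix_def)
    moreover have "g w \<in> words b" using True strong_emb_words[OF g] by blast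
    ultimately have "x \<in> words b" by simp
    then show ?thesis using True x by (simp add: d_def take_in_words)
  qed (auto simp: d_def tail_shift_def)
  ultimately show ?thesis using that by blast
qed

definition tail_map :: "nat \<Rightarrow> nat \<Rightarrow> (nat list \<Rightarrow> nat list \<Rightarrow> nat list) \<Rightarrow> nat list \<Rightarrow> nat list" where
  "tail_map b m Z x = (if x \<in> words b \<and> m \<le> length x then take m x @ Z (take m x) (drop m x) else x)"

lemma tail_map_append [simp]:
  "v \<in> words_of_length b m \<Longrightarrow> z \<in> words b \<Longrightarrow> tail_map b m Z (v @ z) = v @ Z v z"
  by (auto simp: tail_map_def words_of_length_def)

lemma tail_map_strong_emb:
  assumes Z: "\<And>v z. v \<in> words_of_length b m \<Longrightarrow> z \<in> words b \<Longrightarrow> Z v z \<in> words b"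
    "\<And>v v' z z'. v \<in> words_of_length b m \<Longrightarrow> v' \<in> words_of_length b m \<Longrightarrow>
      z \<in> words b \<Longrightarrow> z' \<in> words b \<Longrightarrow> length z = length z' \<Longrightarrow> length (Z v z) = length (Z v' z')"
    "\<And>v z c. v \<in> words_of_length b m \<Longrightarrow> z \<in> words b \<Longrightarrow> c < b \<Longrightarrow> prefix (Z v z @ [c]) (Z v (z @ [c]))"
  shows "tail_map b m Z \<in> strong_emb b m"
proof (rule strong_embI)
  fix x assume "x \<in> words b"
  then show "tail_map b m Z x \<in> words b"
    using Z(1)[of "take m x" "drop m x"] by (auto simp: tail_map_def take_in_words drop_in_words words_of_length_def)
next
  fix x y assume "x \<in> words b" "y \<in> words b" "length x = length y"
  then show "length (tail_map b m Z x) = length (tail_map b m Z y)"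
    using Z(2)[of "take m x" "take m y" "drop m x" "drop m y"]
    by (auto simp: tail_map_def take_in_words drop_in_words words_of_length_def)
next
  fix x c assume x: "x \<in> words b" "c < (b::nat)"
  show "prefix (tail_map b m Z x @ [c]) (tail_map b m Z (x @ [c]))"
  proof (cases "m \<le> length x")
    case True
    then show ?thesis using x Z(3)[of "take m x" "drop m x" c]
      by (simp add: tail_map_def take_in_words drop_in_words words_of_length_def)
  next
    case False
    then show ?thesis using x by (cases "Suc (length x) = m") (simp_all add: tail_map_def)
  qed
qed (auto simp: tail_map_def)

lemma strong_emb_with_first_levels:
  assumes "x \<in> words b" "\<And>c. c < b \<Longrightarrow> y c \<in> words b" "\<And>c. c < b \<Longrightarrow> prefix (x @ [c]) (y c)"
    "\<And>c. c < b \<Longrightarrow> length (y c) = L"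
  obtains g where "g \<in> strong_emb b 0" "g [] = x" "\<And>c. c < b \<Longrightarrow> g [c] = y c"
proof -
  define g where "g w = (if w \<in> words b then case w of [] \<Rightarrow> x | c # z \<Rightarrow> y c @ z else w)" for w
  have "g \<in> strong_emb b 0"
  proof (rule strong_embI)
    fix w c assume "w \<in> words b" "c < (b::nat)"
    then show "prefix (g w @ [c]) (g (w @ [c]))"
      using assms(3)[of c] by (auto simp: g_def split: list.split)
  next
    fix u w assume "u \<in> words b" "w \<in> words b" "length u = length w"
    then show "length (g u) = length (g w)" using assms(4) by (auto simp: g_def split: list.split)
  next
    fix w assume "w \<in> words b"
    then show "g w \<in> words b" using assms(1,2) by (auto simp: g_def split: list.split)
  qed (auto simp: g_def)
  then show ?thesis using that[of g] by (simp add: g_def)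
qed

section \<open>Fusion\<close>

text \<open>
  A finite configuration for a fusion of stage \<open>n\<close>: \<open>m\<close> levels of a strong subtree below level \<open>n\<close>,
  together with the words of length \<open>n\<close> above which it will be continued.
\<close>
definition leveled :: "nat \<Rightarrow> nat \<Rightarrow> nat \<Rightarrow> (nat list \<Rightarrow> nat list) \<Rightarrow> bool" where
  "leveled b m n g \<longleftrightarrow> g \<in> strong_emb b 0 \<and> tail_shift b m g = g \<and>
     (\<forall>v\<in>words_of_length b m. length (g v) = n)"

lemma leveledD:
  assumes "leveled b m n g"
  shows "g \<in> strong_emb b 0" "\<And>v w. v \<in> words b \<Longrightarrow> w \<in> words b \<Longrightarrow> length v = m \<Longrightarrow> g (v @ w) = g v @ w"
    "\<And>v. v \<in> words b \<Longrightarrow> length v = m \<Longrightarrow> length (g v) = n"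
  using assms tail_shift_append[of _ b _ m g] by (auto simp: leveled_def words_of_length_def)

lemma leveled_length_less:
  assumes g: "leveled b m n g" and "0 < b" and w: "w \<in> words b" "length w < m"
  shows "length (g w) < n"
proof -
  have v: "w @ replicate (m - length w) 0 \<in> words b" "length (w @ replicate (m - length w) 0) = m"
    using assms by (auto simp: words_def)
  then show ?thesis
    using strong_emb_length_less[OF leveledD(1)[OF g] w(1) v(1)] leveledD(3)[OF g v] w(2) by simp
qed

text \<open>
  A thinning \<open>\<delta>\<close> of the ambient tree beyond level \<open>n\<close> acts on a configuration of stage \<open>n\<close> as a
  thinning of that configuration.
\<close>
lemma pull_thinning:
  assumes g: "leveled b m n g" and d: "\<delta> \<in> strong_emb b n"
    and b: "0 < b"
  obtains d where "d \<in> strong_emb b m" "\<delta> \<circ> g = g \<circ> d"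
proof -
  note gE = leveledD[OF g]
  define d where "d w = (if w \<in> words b \<and> m \<le> length w then take m w @ drop n (\<delta> (g w)) else w)" for w
  have \<delta>g: "\<delta> \<circ> g \<in> strong_emb b 0" using gE(1) strong_emb_0[OF d] by blast
  have len: "length (g (take m w)) = n" if "w \<in> words b" "m \<le> length w" for w
    using that gE(3)[of "take m w"] by (simp add: take_in_words)
  have gw: "g w = g (take m w) @ drop m w" if "w \<in> words b" "m \<le> length w" for w
    using that gE(2)[of "take m w" "drop m w"] by (simp add: take_in_words drop_in_words)
  have pre: "prefix (g (take m w)) (\<delta> (g w))" if "w \<in> words b" "m \<le> length w" for w
    using strong_emb_words[OF gE(1) that(1)] len[OF that] gw[OF that]
    by (intro strong_emb_fixed_prefix[OF d]) (metis prefixI)+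
  have "d \<in> strong_emb b m"
  proof (rule strong_embI)
    fix w c assume w: "w \<in> words b" "c < (b::nat)"
    show "prefix (d w @ [c]) (d (w @ [c]))"
    proof (cases "m \<le> length w")
      case True
      obtain x where x: "\<delta> (g w) = g (take m w) @ x" using pre[OF w(1) True] by (auto simp: prefix_def)
      obtain y where "\<delta> (g (w @ [c])) = \<delta> (g w) @ c # y"
        using strong_emb_succ[OF \<delta>g w] by (auto simp: prefix_def)
      then show ?thesis using x w True len[OF w(1) True] by (simp add: d_def)
    next
      case False
      then show ?thesis using w by (cases "Suc (length w) = m") (simp_all add: d_def)
    qed
  next
    fix u w assume *: "u \<in> words b" "w \<in> words b" "length u = length w"
    then have "length (\<delta> (g u)) = length (\<delta> (g w))"
      using strong_emb_length_eq[OF \<delta>g, of u w] by simp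
    then show "length (d u) = length (d w)" using * by (simp add: d_def)
  next
    fix w assume "w \<in> words b"
    then show "d w \<in> words b"
      using strong_emb_words[OF \<delta>g, of w] by (simp add: d_def take_in_words drop_in_words)
  qed (auto simp: d_def)
  moreover have "(\<delta> \<circ> g) w = (g \<circ> d) w" for w
  proof (cases "w \<in> words b \<and> m \<le> length w")
    case True
    then obtain x where x: "\<delta> (g w) = g (take m w) @ x" using pre by (auto simp: prefix_def)
    have "\<delta> (g w) \<in> words b" using True strong_emb_words[OF \<delta>g, of w] by simp
    then have "x \<in> words b" using x by simp
    then show ?thesis using True x len gE(2)[of "take m w" x] by (simp add: d_def take_in_words)
  next
    case False
    show ?thesis
    proof (cases "w \<in> words b")
      case w: True
      have "length (g w) < n" using leveled_length_less[OF g b w] False w by simp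
        then show ?thesis using False w strong_emb_fixed[OF d strong_emb_words[OF gE(1) w]] by (simp add: d_def)
    next
      case w: False
      then show ?thesis using strong_emb_outside[OF gE(1)] strong_emb_outside[OF d] by (simp add: d_def)
    qed
  qed
  ultimately show ?thesis using that by blast
qed


text \<open>
  Conversely, each thinning of a configuration comes from a thinning of the ambient tree. The cones that
  the configuration does not use only have to follow the same levels, so they copy the cone above
  \<open>replicate m 0\<close>.
\<close>
lemma push_thinning:
  assumes g: "leveled b m n g" and d: "d \<in> strong_emb b m" and b: "0 < b"
  obtains \<delta> where "\<delta> \<in> strong_emb b n" "\<delta> \<circ> g = g \<circ> d"
proof -
  note gE = leveledD[OF g]
  define \<sigma> where "\<sigma> y = (if y \<in> g ` words_of_length b m
    then inv_into (words_of_length b m) g y else replicate m 0)" for y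
  have \<sigma>: "\<sigma> y \<in> words b" "length (\<sigma> y) = m" for y
  proof -
    have "\<sigma> y \<in> words_of_length b m"
    proof (cases "y \<in> g ` words_of_length b m")
      case True
      from inv_into_into[OF this] True show ?thesis by (simp add: \<sigma>_def)
    next
      case False
      then show ?thesis using b by (auto simp: \<sigma>_def words_of_length_def words_def)
    qed
    then show "\<sigma> y \<in> words b" "length (\<sigma> y) = m" by (simp_all add: words_of_length_def)
  qed
  have inj: "inj_on g (words_of_length b m)"
    using strong_emb_inj[OF gE(1)] by (auto simp: inj_on_def words_of_length_def)
  have \<sigma>g: "\<sigma> (g v) = v" if "v \<in> words b" "length v = m" for v
    using that inv_into_f_f[OF inj, of v] by (auto simp: \<sigma>_def words_of_length_def)
  define \<delta> where "\<delta> x = (if x \<in> words b \<and> n \<le> length x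
    then take n x @ drop m (d (\<sigma> (take n x) @ drop n x)) else x)" for x
  have pre: "prefix (\<sigma> y) (d (\<sigma> y @ z))" if "z \<in> words b" for y z
    using that \<sigma> by (intro strong_emb_fixed_prefix[OF d]) auto
  have "\<delta> \<in> strong_emb b n"
  proof (rule strong_embI)
    fix x c assume x: "x \<in> words b" "c < (b::nat)"
    show "prefix (\<delta> x @ [c]) (\<delta> (x @ [c]))"
    proof (cases "n \<le> length x")
      case True
      let ?s = "\<sigma> (take n x)" and ?z = "drop n x"
      obtain a where a: "d (?s @ ?z) = ?s @ a"
        using pre[of ?z "take n x"] x(1) by (auto simp: prefix_def drop_in_words)
      obtain a' where "d ((?s @ ?z) @ [c]) = d (?s @ ?z) @ c # a'"
        using strong_emb_succ[OF d, of "?s @ ?z" c] x \<sigma> by (auto simp: prefix_def drop_in_words)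
      then show ?thesis using a x True \<sigma> by (simp add: \<delta>_def)
    next
      case False
      then show ?thesis using x by (cases "Suc (length x) = n") (simp_all add: \<delta>_def)
    qed
  next
    fix x y assume *: "x \<in> words b" "y \<in> words b" "length x = length y"
    then have "length (d (\<sigma> (take n x) @ drop n x)) = length (d (\<sigma> (take n y) @ drop n y))"
      using \<sigma> by (intro strong_emb_length_eq[OF d]) (auto simp: drop_in_words)
    then show "length (\<delta> x) = length (\<delta> y)" using * by (simp add: \<delta>_def)
  next
    fix x assume "x \<in> words b"
    then show "\<delta> x \<in> words b"
      using \<sigma> by (auto simp: \<delta>_def take_in_words drop_in_words intro!: drop_in_words strong_emb_words[OF d])
  qed (auto simp: \<delta>_def)
  moreover have "(\<delta> \<circ> g) w = (g \<circ> d) w" for w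
  proof (cases "w \<in> words b \<and> m \<le> length w")
    case True
    let ?v = "take m w" and ?z = "drop m w"
    have vz: "?v \<in> words b" "length ?v = m" "?z \<in> words b"
      using True by (auto simp: take_in_words drop_in_words)
    have len: "length (g ?v) = n" using gE(3) vz by blast
    have gw: "g w = g ?v @ ?z" using gE(2)[OF vz(1,3,2)] by simp
    obtain a where a: "d w = ?v @ a"
      using pre[OF vz(3), of "g ?v"] \<sigma>g[OF vz(1,2)] by (auto simp: prefix_def)
    have "a \<in> words b" using a strong_emb_words[OF d, of w] True by simp
    then have "g (d w) = g ?v @ a" using a gE(2)[OF vz(1) _ vz(2)] by simp
    moreover have "g w \<in> words b" using True strong_emb_words[OF gE(1)] by blast
    then have "\<delta> (g w) = g ?v @ drop m (d (?v @ ?z))"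
      using gw len \<sigma>g[OF vz(1,2)] by (simp add: \<delta>_def)
    ultimately show ?thesis using a vz(2) by simp
  next
    case False
    show ?thesis
    proof (cases "w \<in> words b")
      case w: True
      then have "length (g w) < n" using leveled_length_less[OF g b] False by simp
      then show ?thesis using False w strong_emb_fixed[OF d] by (simp add: \<delta>_def)
    next
      case w: False
      then show ?thesis using strong_emb_outside[OF gE(1)] strong_emb_outside[OF d] by (simp add: \<delta>_def)
    qed
  qed
  ultimately show ?thesis using that by blast
qed

text \<open>
  The reason that a stage of a fusion has only finitely many tasks: a configuration is determined by its
  values on the words of length at most \<open>m\<close>, which are words of length at most \<open>n\<close>.
\<close>
lemma finite_leveled:
  assumes b: "0 < b" shows "finite {g. leveled b m n g}"
proof (rule finite_imageD)
  let ?S = "\<lambda>k. {w \<in> words b. length w \<le> k}"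
  have fin: "finite (?S k)" for k
  proof -
    have "?S k = (\<Union>i\<le>k. words_of_length b i)" by (auto simp: words_of_length_def)
    then show ?thesis by (simp add: finite_words_of_length)
  qed
  let ?r = "\<lambda>g. restrict g (?S m)"
  have "?r ` {g. leveled b m n g} \<subseteq> ?S m \<rightarrow>\<^sub>E ?S n"
  proof (intro image_subsetI PiE_I)
    fix g w assume "g \<in> {g. leveled b m n g}" and "w \<in> ?S m"
    then have g: "leveled b m n g" and w: "w \<in> words b" "length w \<le> m" by auto
    have "length (g w) \<le> n"
      using w leveled_length_less[OF g b w(1)] leveledD(3)[OF g w(1)] by (cases "length w = m") auto
    then show "restrict g (?S m) w \<in> ?S n"
      using w strong_emb_words[OF leveledD(1)[OF g]] by simp
  next
    fix g :: "nat list \<Rightarrow> nat list" and w assume "w \<notin> ?S m"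
    then show "restrict g (?S m) w = undefined" by auto
  qed
  then show "finite (?r ` {g. leveled b m n g})" by (rule finite_subset[OF _ finite_PiE[OF fin fin]])
  show "inj_on ?r {g. leveled b m n g}"
  proof (rule inj_onI, clarify, rule ext)
    fix g h w assume g: "leveled b m n g" and h: "leveled b m n h" and eq: "?r g = ?r h"
    have eq': "g u = h u" if "u \<in> words b" "length u \<le> m" for u
      using fun_cong[OF eq, of u] that by simp
    show "g w = h w"
    proof (cases "w \<in> words b \<and> m \<le> length w")
      case True
      then show ?thesis
        using leveledD(2)[OF g, of "take m w" "drop m w"] leveledD(2)[OF h, of "take m w" "drop m w"]
          eq'[of "take m w"] by (simp add: take_in_words drop_in_words)
    next
      case False
      then show ?thesis
        using eq'[of w] strong_emb_outside[OF leveledD(1)[OF g]] strong_emb_outside[OF leveledD(1)[OF h]]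
        by (cases "w \<in> words b") auto
    qed
  qed
qed

primrec comp_from :: "(nat \<Rightarrow> 'a \<Rightarrow> 'a) \<Rightarrow> nat \<Rightarrow> nat \<Rightarrow> 'a \<Rightarrow> 'a" where
  "comp_from d 0 n = id"
| "comp_from d (Suc j) n = d n \<circ> comp_from d j (Suc n)"

text \<open>
  The limit of the compositions \<open>d 0 \<circ> \<dots> \<circ> d n\<close>: it exists since the value at a word of length \<open>l\<close> no
  longer changes after the factor \<open>d l\<close>. The maps \<open>D n\<close> are the limits of the tails.
\<close>
lemma infinite_composition:
  assumes d: "\<And>n. d n \<in> strong_emb b n"
  obtains D where "\<And>n. D n \<in> strong_emb b n" "\<And>n. D n = d n \<circ> D (Suc n)"
proof -
  let ?c = "comp_from d"
  have c: "?c j n \<in> strong_emb b n" for j n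
  proof (induction j arbitrary: n)
    case (Suc j)
    then have "?c j (Suc n) \<in> strong_emb b n" using strong_emb_antimono[of n "Suc n" b] by auto
    then show ?case using d by (simp only: comp_from.simps) (rule strong_emb_comp)
  qed (simp only: comp_from.simps id_strong_emb)
  have stable1: "?c (Suc j) n w = ?c j n w" if "length w < n + j" for j n w
    using that
  proof (induction j arbitrary: n)
    case 0
    then show ?case using strong_emb_fixed[OF d] strong_emb_outside[OF d] by (cases "w \<in> words b") auto
  next
    case (Suc j)
    then show ?case using Suc.IH[of "Suc n"] by simp
  qed
  have stable: "?c (j + i) n w = ?c j n w" if "length w < n + j" for i j n w
    using that by (induction i) (auto simp del: comp_from.simps simp: stable1)
  define D where "D n w = ?c (Suc (length w)) n w" for n w
  have D: "D n w = ?c j n w" if "length w < j" for n j w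
    using stable[of w n "Suc (length w)" "j - Suc (length w)"] that by (simp add: D_def del: comp_from.simps)
  have "D n \<in> strong_emb b n" for n
  proof (rule strong_embI)
    fix u w assume "u \<in> words b" "w \<in> words b" "length u = length w"
    then show "length (D n u) = length (D n w)"
      using strong_emb_length_eq[OF c, of u w "Suc (length w)" n] by (simp add: D_def del: comp_from.simps)
  next
    fix w c' assume "w \<in> words b" "c' < (b::nat)"
    then show "prefix (D n w @ [c']) (D n (w @ [c']))"
      using strong_emb_succ[OF c, of w c' "Suc (Suc (length w))" n] D[of w "Suc (Suc (length w))" n]
      by (simp add: D_def[of n "w @ [c']"] del: comp_from.simps)
  qed (use strong_emb_outside[OF c] strong_emb_words[OF c] strong_emb_fixed[OF c] in
      \<open>auto simp: D_def simp del: comp_from.simps\<close>)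
  moreover have "D n = d n \<circ> D (Suc n)" for n
  proof
    fix w
    have "D n w = ?c (Suc (Suc (length w))) n w" by (rule D) simp
    also have "\<dots> = d n (D (Suc n) w)" unfolding D_def by simp
    finally show "D n w = (d n \<circ> D (Suc n)) w" by simp
  qed
  ultimately show ?thesis using that by blast
qed

text \<open>
  A property of pairs of a level \<open>m\<close> and an embedding that survives thinning and that can be achieved by
  thinning can be achieved by one thinning for all strong subtrees of \<open>f \<circ> d\<close> and all levels
  \<open>m \<ge> n0\<close> at once. At stage \<open>n\<close> the finitely many configurations of stage \<open>n\<close> are treated one after
  another, by thinnings beyond level \<open>n\<close>, which do not disturb what the earlier stages have fixed.
\<close>
lemma fusion:
  assumes b: "0 < b"
    and hereditary: "\<And>m f d. f \<in> strong_emb b 0 \<Longrightarrow> d \<in> strong_emb b m \<Longrightarrow> \<Theta> m f \<Longrightarrow> \<Theta> m (f \<circ> d)"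
    and dense: "\<And>m f. f \<in> strong_emb b 0 \<Longrightarrow> \<exists>d\<in>strong_emb b m. \<Theta> m (f \<circ> d)"
    and f: "f \<in> strong_emb b 0"
  obtains d where "d \<in> strong_emb b n0" "\<And>m g. n0 \<le> m \<Longrightarrow> g \<in> strong_emb b 0 \<Longrightarrow> \<Theta> m (f \<circ> d \<circ> g)"
proof -
  have stage: "\<exists>d\<in>strong_emb b n. \<forall>m g. leveled b m n g \<longrightarrow> \<Theta> m (e \<circ> d \<circ> g)"
    if e: "e \<in> strong_emb b 0" for e n
  proof -
    have part: "\<exists>d\<in>strong_emb b n. \<forall>(m, g)\<in>F. \<Theta> m (e \<circ> d \<circ> g)"
      if "finite F" "\<forall>(m, g)\<in>F. leveled b m n g" for F
      using that
    proof (induction F rule: finite_induct)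
      case empty
      show ?case by (rule bexI[of _ id]) auto
    next
      case (insert x F)
      obtain m g where x: "x = (m, g)" by (cases x)
      then have g: "leveled b m n g" using insert.prems by auto
      have "\<forall>(m, g)\<in>F. leveled b m n g" using insert.prems by blast
      from insert.IH[OF this] obtain d where d: "d \<in> strong_emb b n" "\<forall>(m, g)\<in>F. \<Theta> m (e \<circ> d \<circ> g)"
        by blast
      have ed: "e \<circ> d \<in> strong_emb b 0" using e strong_emb_0[OF d(1)] by blast
      have "e \<circ> d \<circ> g \<in> strong_emb b 0" using ed leveledD(1)[OF g] by blast
      from dense[OF this] obtain d' where d': "d' \<in> strong_emb b m" "\<Theta> m (e \<circ> d \<circ> g \<circ> d')"
        by blast
      obtain \<delta> where \<delta>: "\<delta> \<in> strong_emb b n" "\<delta> \<circ> g = g \<circ> d'"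
        using push_thinning[OF g d'(1) b] by blast
      have "\<Theta> m' (e \<circ> (d \<circ> \<delta>) \<circ> g')" if "(m', g') \<in> F" for m' g'
      proof -
        have g': "leveled b m' n g'" using insert.prems that by auto
        obtain d'' where d'': "d'' \<in> strong_emb b m'" "\<delta> \<circ> g' = g' \<circ> d''"
          using pull_thinning[OF g' \<delta>(1) b] by blast
        have "e \<circ> d \<circ> g' \<in> strong_emb b 0" using ed leveledD(1)[OF g'] by blast
        then have "\<Theta> m' (e \<circ> d \<circ> g' \<circ> d'')"
          using hereditary[OF _ d''(1)] d(2) that by auto
        then show ?thesis using d''(2) by (simp add: comp_assoc)
      qed
      moreover have "\<Theta> m (e \<circ> (d \<circ> \<delta>) \<circ> g)"
        using d'(2) \<delta>(2) by (simp add: comp_assoc)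
      ultimately have "\<forall>(m', g')\<in>insert x F. \<Theta> m' (e \<circ> (d \<circ> \<delta>) \<circ> g')"
        unfolding x by blast
      moreover have "d \<circ> \<delta> \<in> strong_emb b n" using d(1) \<delta>(1) by (rule strong_emb_comp)
      ultimately show ?case by blast
    qed
    define F where "F = (SIGMA m:{..n}. {g. leveled b m n g})"
    have "m \<le> n" if "leveled b m n g" for m g
    proof -
      have "replicate m 0 \<in> words b" using b by (auto simp: words_def)
      then show ?thesis
        using leveledD(3)[OF that, of "replicate m 0"] strong_emb_length_ge[OF leveledD(1)[OF that], of "replicate m 0"] by simp
    qed
    then have F: "(m, g) \<in> F \<longleftrightarrow> leveled b m n g" for m g by (auto simp: F_def)
    have "finite F" by (simp add: F_def finite_leveled[OF b])
    from part[OF this] F show ?thesis by fastforce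
  qed
  define pick where "pick e n = (if n < n0 then id else
    (SOME d. d \<in> strong_emb b n \<and> (\<forall>m g. leveled b m n g \<longrightarrow> \<Theta> m (e \<circ> d \<circ> g))))" for e n
  have pick_emb: "pick e n \<in> strong_emb b n" if "e \<in> strong_emb b 0" for e n
    using someI_ex[OF stage[OF that, of n, unfolded Bex_def]] by (auto simp: pick_def)
  have pick: "\<Theta> m (e \<circ> pick e n \<circ> g)" if "e \<in> strong_emb b 0" "n0 \<le> n" "leveled b m n g" for e n m g
    using someI_ex[OF stage[OF that(1), of n, unfolded Bex_def]] that by (auto simp: pick_def)
  define fs where "fs = rec_nat f (\<lambda>n e. e \<circ> pick e n)"
  have fs_Suc: "fs (Suc n) = fs n \<circ> pick (fs n) n" and fs_0: "fs 0 = f" for n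
    by (simp_all add: fs_def)
  have fs: "fs n \<in> strong_emb b 0" for n
  proof (induction n)
    case (Suc n)
    show ?case unfolding fs_Suc by (rule strong_emb_comp[OF Suc strong_emb_0[OF pick_emb[OF Suc]]])
  qed (simp add: fs_0 f)
  obtain D where D: "\<And>n. D n \<in> strong_emb b n" "\<And>n. D n = pick (fs n) n \<circ> D (Suc n)"
    using infinite_composition[of "\<lambda>n. pick (fs n) n" b] pick_emb fs by blast
  have fD: "f \<circ> D 0 = fs n \<circ> D n" for n
  proof (induction n)
    case (Suc n)
    show ?case unfolding fs_Suc comp_assoc D(2)[symmetric] by (rule Suc)
  qed (simp only: fs_0)
  have "D 0 = D n" if "n \<le> n0" for n
    using that
  proof (induction n)
    case (Suc n)
    then have "D n = D (Suc n)" using D(2)[of n] by (simp add: pick_def)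
    then show ?case using Suc by simp
  qed simp
  from this[of n0] have "D 0 \<in> strong_emb b n0" using D(1)[of n0] by simp
  moreover have "\<Theta> m (f \<circ> D 0 \<circ> g)" if m: "n0 \<le> m" and g: "g \<in> strong_emb b 0" for m g
  proof -
    \<comment> \<open>the stage at which the configuration given by the first \<open>m\<close> levels of \<open>g\<close> was treated\<close>
    define n where "n = length (g (replicate m 0))"
    have r: "replicate m 0 \<in> words b" using b by (auto simp: words_def)
    have "m \<le> n" using strong_emb_length_ge[OF g r] by (simp add: n_def)
    define h where "h = tail_shift b m g"
    have h: "leveled b m n h"
      unfolding leveled_def
    proof (intro conjI ballI)
      show "h \<in> strong_emb b 0" using tail_shift_strong_emb[OF g, of m] by (simp add: h_def)
      show "tail_shift b m h = h" by (rule ext) (auto simp: h_def tail_shift_def take_in_words)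
      fix v assume "v \<in> words_of_length b m"
      then show "length (h v) = n"
        using strong_emb_length_eq[OF g _ r, of v] by (simp add: h_def n_def tail_shift_def words_of_length_def)
    qed
    obtain d where d: "d \<in> strong_emb b (Suc m)" "g = h \<circ> d"
      using tail_shift_factor[OF g, of m] by (auto simp: h_def)
    have d_m: "d \<in> strong_emb b m" using d(1) strong_emb_antimono[of m "Suc m" b] by auto
    have "D (Suc n) \<in> strong_emb b n" using D(1)[of "Suc n"] strong_emb_antimono[of n "Suc n" b] by auto
    then obtain d' where d': "d' \<in> strong_emb b m" "D (Suc n) \<circ> h = h \<circ> d'"
      using pull_thinning[OF h _ b] by blast
    let ?e = "fs n \<circ> pick (fs n) n \<circ> h"
    have "\<Theta> m ?e" using pick[OF fs _ h] m \<open>m \<le> n\<close> by simp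
    moreover have "?e \<in> strong_emb b 0"
      using fs strong_emb_0[OF pick_emb[OF fs]] leveledD(1)[OF h] by blast
    ultimately have "\<Theta> m (?e \<circ> (d' \<circ> d))"
      using hereditary[of ?e "d' \<circ> d" m] strong_emb_comp[OF d'(1) d_m] by blast
    moreover have "f \<circ> D 0 \<circ> g = fs n \<circ> (pick (fs n) n \<circ> D (Suc n)) \<circ> (h \<circ> d)"
      by (simp only: fD[of n] D(2)[of n, symmetric] d(2)[symmetric])
    then have "f \<circ> D 0 \<circ> g = ?e \<circ> (d' \<circ> d)"
      using d'(2) by (metis comp_assoc)
    ultimately show ?thesis by simp
  qed
  ultimately show ?thesis using that by blast
qed

section \<open>Milliken's theorem for closed families\<close>

text \<open>
  The Halpern--Laeuchli theorem for homogeneous trees, in the form of a pigeonhole principle for adding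
  one level: \<open>P\<close> colours the tuples of words of equal length above the words of length \<open>m\<close>. Reading such
  a tuple as one word over the alphabet \<open>\<Lambda>\<close> of functions on level \<open>m\<close>, the Carlson--Simpson theorem gives a
  monochromatic tree of tuples; its coordinates are the actions of a strong embedding on the cones.
\<close>
lemma level_pigeonhole:
  assumes local: "\<And>h h'. h \<in> strong_emb b m \<Longrightarrow> h' \<in> strong_emb b m \<Longrightarrow>
      (\<And>v. v \<in> words_of_length b m \<Longrightarrow> h v = h' v) \<Longrightarrow> P h = P h'"
  obtains d where "d \<in> strong_emb b m"
    "(\<forall>h\<in>strong_emb b m. P (d \<circ> h)) \<or> (\<forall>h\<in>strong_emb b m. \<not> P (d \<circ> h))"
proof -
  let ?V = "words_of_length b m"
  define \<Lambda> where "\<Lambda> = (?V \<rightarrow>\<^sub>E {..<b})"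
  have "finite \<Lambda>" unfolding \<Lambda>_def by (intro finite_PiE finite_words_of_length) simp
  define pr where "pr v a = a v" for v :: "nat list" and a :: "nat list \<Rightarrow> nat"
  have pr_\<Lambda>: "pr v a < b" if "v \<in> ?V" "a \<in> \<Lambda>" for v a
    using that by (auto simp: pr_def \<Lambda>_def PiE_def Pi_def)
  define C where "C = {Y. P (tail_map b m (\<lambda>v z. map (pr v) Y @ z))}"
  \<comment> \<open>each coordinate of this tree is the action of \<open>d\<close> on one cone\<close>
  obtain x t where x: "x \<in> lists \<Lambda>" and t: "\<And>j. t j \<in> lists (insert None (Some ` \<Lambda>))"
    and C: "(\<forall>y\<in>lists \<Lambda>. cs_word x t y \<in> C) \<or> (\<forall>y\<in>lists \<Lambda>. cs_word x t y \<notin> C)"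
    using carlson_simpson[OF \<open>finite \<Lambda>\<close>] by metis
  define Z where "Z v = cs_word (map (pr v) x) (\<lambda>j. map (map_option (pr v)) (t j))" for v
  define d where "d = tail_map b m Z"
  have d: "d \<in> strong_emb b m" unfolding d_def
  proof (rule tail_map_strong_emb)
    fix v z assume v: "v \<in> ?V" and z: "z \<in> words b"
    have "map (pr v) x \<in> lists {..<b}" using x pr_\<Lambda>[OF v] by auto
    moreover have "map (map_option (pr v)) (t j) \<in> lists (insert None (Some ` {..<b}))" for j
      using t[of j] pr_\<Lambda>[OF v] by (fastforce simp: in_lists_conv_set)
    ultimately show "Z v z \<in> words b"
      using z unfolding Z_def words_def by (intro cs_word_in_lists) auto
  qed (simp_all add: Z_def length_cs_word cs_word_snoc)
  have "\<exists>Y\<in>lists \<Lambda>. P (d \<circ> h) \<longleftrightarrow> cs_word x t Y \<in> C" if h: "h \<in> strong_emb b m" for h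
  proof -
    define z where "z v = drop m (h v)" for v
    have hv: "h v = v @ z v" if "v \<in> ?V" for v
      using that strong_emb_fixed_prefix[OF h, of v v] by (auto simp: z_def prefix_def words_of_length_def)
    have zw: "z v \<in> words b" if "v \<in> ?V" for v
      using that strong_emb_words[OF h, of v] by (auto simp: z_def drop_in_words words_of_length_def)
    obtain n where n: "\<And>v. v \<in> ?V \<Longrightarrow> length (z v) = n"
    proof (cases "?V = {}")
      case False
      then obtain v0 where "v0 \<in> ?V" by blast
      then have "length (z v) = length (z v0)" if "v \<in> ?V" for v
        using that strong_emb_length_eq[OF h, of v v0] by (auto simp: z_def words_of_length_def)
      then show ?thesis using that by blast
    qed auto
    define y where "y = map (\<lambda>j. restrict (\<lambda>v. z v ! j) ?V) [0..<n]"
    have y: "y \<in> lists \<Lambda>"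
    proof -
      have "z v ! j < b" if "v \<in> ?V" "j < n" for v j
        using zw[OF that(1)] n[OF that(1)] that(2) by (metis in_lists_conv_set lessThan_iff nth_mem words_def)
      then show ?thesis by (auto simp: y_def \<Lambda>_def)
    qed
    have yv: "map (pr v) y = z v" if "v \<in> ?V" for v
      using n[OF that] that by (intro nth_equalityI) (auto simp: y_def pr_def)
    have "P (d \<circ> h) = P (tail_map b m (\<lambda>v z. map (pr v) (cs_word x t y) @ z))"
    proof (rule local)
      show "d \<circ> h \<in> strong_emb b m" using d h by (rule strong_emb_comp)
      show "tail_map b m (\<lambda>v z. map (pr v) (cs_word x t y) @ z) \<in> strong_emb b m"
      proof (rule tail_map_strong_emb)
        fix v w assume v: "v \<in> ?V" and w: "w \<in> words b"
        have "cs_word x t y \<in> lists \<Lambda>" using x t y by (rule cs_word_in_lists)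
        then show "map (pr v) (cs_word x t y) @ w \<in> words b"
          using w pr_\<Lambda>[OF v] by (auto simp: words_def)
      qed auto
      fix v assume v: "v \<in> ?V"
      have "(d \<circ> h) v = d (v @ z v)" using hv[OF v] by simp
      also have "\<dots> = v @ Z v (z v)" using v zw[OF v] by (simp add: d_def)
      also have "\<dots> = v @ map (pr v) (cs_word x t y)"
        unfolding map_cs_word yv[OF v] by (simp add: Z_def)
      also have "\<dots> = tail_map b m (\<lambda>v z. map (pr v) (cs_word x t y) @ z) v" 
        using v tail_map_append[of v b m "[]"] by simp
      finally show "(d \<circ> h) v = tail_map b m (\<lambda>v z. map (pr v) (cs_word x t y) @ z) v" .
    qed
    then show ?thesis using y by (auto simp: C_def)
  qed
  then show ?thesis using that[OF d] C by blast
qed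

text \<open>
  The set of embeddings without a bad initial segment is closed, and the theorem says that it is Ramsey
  once it meets every set of thinnings. Call \<open>m\<close> levels of \<open>f\<close> accepted if every continuation inside \<open>f\<close>
  runs into a bad initial segment, and rejected if they are not accepted after any thinning. By the
  hypothesis nothing is accepted at level \<open>0\<close>. If \<open>m\<close> levels are rejected, then after thinning all their
  one-level extensions are rejected: first a fusion makes every extension accepted or rejected, then
  the pigeonhole principle makes all of them alike, and if all were accepted, so would be the \<open>m\<close> levels.
  A second fusion does this everywhere at once, and a bad initial segment is never rejected.
\<close>
theorem milliken_closed:
  assumes b: "0 < b"
    and local: "\<And>k f f'. (\<And>w. w \<in> words b \<Longrightarrow> length w < k \<Longrightarrow> f w = f' w) \<Longrightarrow> bad k f = bad k f'"
    and good: "\<And>e. e \<in> strong_emb b 0 \<Longrightarrow> \<exists>g\<in>strong_emb b 0. \<forall>k. \<not> bad k (e \<circ> g)"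
  obtains e where "e \<in> strong_emb b 0" "\<And>g k. g \<in> strong_emb b 0 \<Longrightarrow> \<not> bad k (e \<circ> g)"
proof -
  let ?E = "strong_emb b"
  define Acc where "Acc m f \<longleftrightarrow> (\<forall>d\<in>?E m. \<exists>k. bad k (f \<circ> d))" for m f
  define Rej where "Rej m f \<longleftrightarrow> (\<forall>d\<in>?E m. \<not> Acc m (f \<circ> d))" for m f
  have Acc_thin: "Acc m (f \<circ> d)" if "Acc m f" "d \<in> ?E m" for m f d
    using that strong_emb_comp[OF that(2)] unfolding Acc_def comp_assoc by blast
  have Rej_thin: "Rej m (f \<circ> d)" if "Rej m f" "d \<in> ?E m" for m f d
    using that strong_emb_comp[OF that(2)] unfolding Rej_def comp_assoc by blast
  define \<Phi> where "\<Phi> m f \<longleftrightarrow> Acc m f \<or> (\<forall>h\<in>?E m. Rej (Suc m) (f \<circ> h))" for m f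
  have \<Phi>_thin: "\<Phi> m (f \<circ> d)" if "\<Phi> m f" "d \<in> ?E m" for m f d
    using that Acc_thin[of m f d] strong_emb_comp[OF that(2)] unfolding \<Phi>_def comp_assoc by blast
  have \<Phi>_dense: "\<exists>d\<in>?E m. \<Phi> m (f \<circ> d)" if f: "f \<in> ?E 0" for m f
  proof (cases "Rej m f")
    case False
    then show ?thesis unfolding Rej_def \<Phi>_def by blast
  next
    case True
    obtain d1 where d1: "d1 \<in> ?E m"
      and dec: "\<And>k g. m \<le> k \<Longrightarrow> g \<in> ?E 0 \<Longrightarrow> Acc k (f \<circ> d1 \<circ> g) \<or> Rej k (f \<circ> d1 \<circ> g)"
    proof (rule fusion[OF b _ _ f, where \<Theta> = "\<lambda>k f. Acc k f \<or> Rej k f" and ?n0.0 = m])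
      fix k f' d assume "d \<in> ?E k" "Acc k f' \<or> Rej k f'"
      then show "Acc k (f' \<circ> d) \<or> Rej k (f' \<circ> d)" using Acc_thin Rej_thin by blast
    next
      fix k f'
      show "\<exists>d\<in>?E k. Acc k (f' \<circ> d) \<or> Rej k (f' \<circ> d)"
      proof (cases "Rej k f'")
        case True
        then show ?thesis using Rej_thin id_strong_emb by blast
      qed (auto simp: Rej_def)
    qed blast
    let ?f = "f \<circ> d1"
    \<comment> \<open>Whether an extension by one level is accepted is a property of the new level alone if one continues
      in the largest possible reservoir, which is what \<open>tail_shift b m h\<close> does.\<close>
    have via_shift: "\<exists>d\<in>?E (Suc m). ?f \<circ> h = ?f \<circ> tail_shift b m h \<circ> d" if "h \<in> ?E m" for h
      using tail_shift_factor[OF that, of m] by (metis comp_assoc)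
    have shift_E: "tail_shift b m h \<in> ?E m" if "h \<in> ?E m" for h
      using tail_shift_strong_emb[OF that, of m] by simp
    define P where "P h \<longleftrightarrow> Acc (Suc m) (?f \<circ> tail_shift b m h)" for h
    obtain d2 where d2: "d2 \<in> ?E m" and P: "(\<forall>h\<in>?E m. P (d2 \<circ> h)) \<or> (\<forall>h\<in>?E m. \<not> P (d2 \<circ> h))"
    proof (rule level_pigeonhole[of b m P])
      fix h h' assume h: "h \<in> ?E m" "h' \<in> ?E m"
        and eq: "\<And>v. v \<in> words_of_length b m \<Longrightarrow> h v = h' v"
      have "tail_shift b m h w = tail_shift b m h' w" for w
      proof (cases "w \<in> words b \<and> m \<le> length w")
        case True
        then show ?thesis using eq[of "take m w"] by (simp add: tail_shift_def words_of_length_def take_in_words)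
      next
        case False
        then show ?thesis using strong_embD(1,5)[OF h(1)] strong_embD(1,5)[OF h(2)]
          by (cases "w \<in> words b") (auto simp: tail_shift_def)
      qed
      then have "tail_shift b m h = tail_shift b m h'" by blast
      then show "P h = P h'" by (simp add: P_def)
    qed blast
    have d12: "d1 \<circ> d2 \<in> ?E m" using d1 d2 by (rule strong_emb_comp)
    from P show ?thesis
    proof
      assume P: "\<forall>h\<in>?E m. P (d2 \<circ> h)"
      have "Acc m (f \<circ> (d1 \<circ> d2))"
        unfolding Acc_def
      proof
        fix h assume h: "h \<in> ?E m"
        obtain d where "d \<in> ?E (Suc m)" "?f \<circ> (d2 \<circ> h) = ?f \<circ> tail_shift b m (d2 \<circ> h) \<circ> d"
          using via_shift[OF strong_emb_comp[OF d2 h]] by blast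
        then have "Acc (Suc m) (?f \<circ> (d2 \<circ> h))" using P h Acc_thin unfolding P_def by metis
        then have "\<exists>k. bad k (?f \<circ> (d2 \<circ> h) \<circ> id)" unfolding Acc_def using id_strong_emb by blast
        then show "\<exists>k. bad k (f \<circ> (d1 \<circ> d2) \<circ> h)" by (simp only: comp_assoc comp_id)
      qed
      then show ?thesis using True d12 unfolding Rej_def by blast
    next
      assume P: "\<forall>h\<in>?E m. \<not> P (d2 \<circ> h)"
      have "Rej (Suc m) (f \<circ> (d1 \<circ> d2) \<circ> h)" if h: "h \<in> ?E m" for h
      proof -
        let ?h = "d2 \<circ> h"
        have hE: "?h \<in> ?E m" using d2 h by (rule strong_emb_comp)
        obtain d where d: "d \<in> ?E (Suc m)" "?f \<circ> ?h = ?f \<circ> tail_shift b m ?h \<circ> d"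
          using via_shift[OF hE] by blast
        have "\<not> Acc (Suc m) (?f \<circ> tail_shift b m ?h)" using P h unfolding P_def by blast
        then have "Rej (Suc m) (?f \<circ> tail_shift b m ?h)"
          using dec[OF _ strong_emb_0[OF shift_E[OF hE]], of "Suc m"] by simp
        then have "Rej (Suc m) (?f \<circ> ?h)" unfolding d(2) using d(1) by (rule Rej_thin)
        then show ?thesis by (simp only: comp_assoc)
      qed
      then show ?thesis using d12 unfolding \<Phi>_def by blast
    qed
  qed
  obtain e where e: "e \<in> ?E 0" and \<Phi>: "\<And>m g. g \<in> ?E 0 \<Longrightarrow> \<Phi> m (id \<circ> e \<circ> g)"
    using fusion[OF b, of \<Phi> id 0] \<Phi>_thin \<Phi>_dense by (metis id_strong_emb le0)
  have not_Acc: "\<not> Acc m (e \<circ> g)" if g: "g \<in> ?E 0" for m g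
  proof (induction m)
    case 0
    show ?case using good[OF strong_emb_comp[OF e g]] unfolding Acc_def by blast
  next
    case (Suc m)
    then have "\<forall>h\<in>?E m. Rej (Suc m) (e \<circ> g \<circ> h)" using \<Phi>[OF g, of m] unfolding \<Phi>_def id_comp by blast
    then have "Rej (Suc m) (e \<circ> g \<circ> id)" using id_strong_emb by blast
    then have "\<not> Acc (Suc m) (e \<circ> g \<circ> id \<circ> id)" unfolding Rej_def using id_strong_emb by blast
    then show ?case by (simp only: comp_id) simp
  qed
  have "\<not> bad k (e \<circ> g)" if g: "g \<in> ?E 0" for g k
  proof
    assume bad: "bad k (e \<circ> g)"
    have "bad k (e \<circ> g \<circ> d)" if "d \<in> ?E k" for d
      using bad local[of k "e \<circ> g \<circ> d" "e \<circ> g"] strong_emb_fixed[OF that] by simp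
    then have "Acc k (e \<circ> g)" unfolding Acc_def by blast
    then show False using not_Acc[OF g] by blast
  qed
  then show ?thesis using that e by blast
qed

section \<open>Events indexed by words\<close>

text \<open>
  For \<open>i = b\<close> these are the first two levels of a strong subtree; the smaller stars carry the induction
  that adds one direction at a time.
\<close>
definition star_event :: "(nat list \<Rightarrow> 'w set) \<Rightarrow> nat \<Rightarrow> (nat list \<Rightarrow> nat list) \<Rightarrow> 'w set" where
  "star_event B i f = B (f []) \<inter> (\<Inter>c<i. B (f [c]))"

lemma star_event_cong:
  assumes "i \<le> b" "\<And>w. w \<in> words b \<Longrightarrow> length w < 2 \<Longrightarrow> f w = f' w"
  shows "star_event B i f = star_event B i f'"
proof -
  have "f [c] = f' [c]" if "c < i" for c using assms(2)[of "[c]"] assms(1) that by simp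
  then show ?thesis using assms(2)[of "[]"] by (simp add: star_event_def)
qed

context prob_space begin

text \<open>
  The Cauchy--Schwarz inequality for the number of events that occur: its second moment is at least
  the square of its mean. For \<open>n\<close> large, \<open>c\<close> cannot be much smaller than \<open>\<kappa>\<^sup>2\<close>.
\<close>
lemma second_moment:
  assumes X: "\<And>j. j < n \<Longrightarrow> X j \<in> events" and lam: "0 \<le> \<kappa>" "\<And>j. j < n \<Longrightarrow> \<kappa> \<le> prob (X j)"
    and c: "0 \<le> c" "\<And>j l. j < l \<Longrightarrow> l < n \<Longrightarrow> prob (X j \<inter> X l) \<le> c"
  shows "real n * \<kappa>\<^sup>2 \<le> 1 + real n * c"
proof (cases "n = 0")
  case False
  define S where "S x = (\<Sum>j<n. indicator (X j) x :: real)" for x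
  have int: "integrable M (indicator (X j) :: 'a \<Rightarrow> real)" if "j < n" for j
    using X[OF that] by (simp add: emeasure_eq_measure)
  have int2: "integrable M (indicator (X j \<inter> X l) :: 'a \<Rightarrow> real)" if "j < n" "l < n" for j l
    using X that by (auto simp: emeasure_eq_measure)
  have S2: "(S x)\<^sup>2 = (\<Sum>j<n. \<Sum>l<n. indicator (X j \<inter> X l) x)" for x
    by (simp add: S_def power2_eq_square sum_product indicator_inter_arith)
  have intS: "integrable M S" unfolding S_def by (intro Bochner_Integration.integrable_sum) (use int in auto)
  have intS2: "integrable M (\<lambda>x. (S x)\<^sup>2)"
    unfolding S2 by (intro Bochner_Integration.integrable_sum) (use int2 in auto)
  have ES: "expectation S = (\<Sum>j<n. prob (X j))"
    unfolding S_def using int X by (subst Bochner_Integration.integral_sum) auto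
  have ES2: "expectation (\<lambda>x. (S x)\<^sup>2) = (\<Sum>j<n. \<Sum>l<n. prob (X j \<inter> X l))"
    unfolding S2 using int2 X
    by (subst Bochner_Integration.integral_sum) (auto simp: Bochner_Integration.integral_sum intro!: sum.cong)
  have "(real n * \<kappa>)\<^sup>2 \<le> (expectation S)\<^sup>2"
  proof -
    have "real n * \<kappa> = (\<Sum>j<n. \<kappa>)" by simp
    also have "\<dots> \<le> expectation S" unfolding ES using lam by (intro sum_mono) auto
    finally show ?thesis using lam(1) by (intro power_mono) auto
  qed
  also have "\<dots> \<le> expectation (\<lambda>x. (S x)\<^sup>2)"
    using variance_positive[of S] variance_eq[OF intS intS2] by simp
  also have "\<dots> \<le> (\<Sum>j<n. \<Sum>l<n. (if j = l then 1 else 0) + c)"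
    unfolding ES2
  proof (intro sum_mono)
    fix j l assume "j \<in> {..<n}" "l \<in> {..<n}"
    show "prob (X j \<inter> X l) \<le> (if j = l then 1 else 0) + c"
    proof (cases "j = l")
      case True
      have "prob (X j \<inter> X l) \<le> 1 + c" using c(1) prob_le_1 by (rule add_increasing2)
      then show ?thesis using True by simp
    next
      case False
      then show ?thesis
        using c(2)[of j l] c(2)[of l j] \<open>j \<in> {..<n}\<close> \<open>l \<in> {..<n}\<close>
        by (cases j l rule: linorder_cases) (auto simp: Int_commute)
    qed
  qed
  also have "\<dots> = real n * (1 + real n * c)"
    by (simp add: sum.distrib algebra_simps)
  finally have "real n * (real n * \<kappa>\<^sup>2) \<le> real n * (1 + real n * c)"
    by (simp add: power2_eq_square mult_ac)
  then show ?thesis by (rule mult_left_le_imp_le) (use False in simp)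
qed simp

lemma star_event_events:
  assumes "\<And>w. w \<in> words b \<Longrightarrow> B w \<in> events" "f \<in> strong_emb b 0" "i \<le> b"
  shows "star_event B i f \<in> events"
proof -
  have *: "B (f w) \<in> events" if "w \<in> words b" for w
    using that assms(1) strong_emb_words[OF assms(2)] by blast
  have "star_event B i f = (\<Inter>w\<in>insert [] ((\<lambda>c. [c]) ` {..<i}). B (f w))" by (simp add: star_event_def)
  also have "\<dots> \<in> events" by (rule sets.finite_INT) (use * assms(3) in auto)
  finally show ?thesis .
qed

text \<open>
  The doubling step. In the comb of nodes \<open>i\<^sup>j\<close>, take at each node a star in the directions below \<open>i\<close>, with
  all leaves in one level. For \<open>j < l\<close> every node of the \<open>l\<close>-th star lies above direction \<open>i\<close> of the \<open>j\<close>-th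
  node, so the two stars together contain a star in the directions below \<open>i + 1\<close>, and by the second
  moment bound some two of them have a large intersection.
\<close>
lemma star_step:
  assumes b: "0 < b" and B: "\<And>w. w \<in> words b \<Longrightarrow> B w \<in> events" and i: "i < b"
    and e: "e \<in> strong_emb b 0"
    and lam: "0 \<le> \<kappa>" "\<And>g. g \<in> strong_emb b 0 \<Longrightarrow> \<kappa> \<le> prob (star_event B i (e \<circ> g))"
    and c: "0 \<le> c" "c < \<kappa>\<^sup>2"
  obtains g where "g \<in> strong_emb b 0" "c \<le> prob (star_event B (Suc i) (e \<circ> g))"
proof -
  obtain n where n: "real n > 1 / (\<kappa>\<^sup>2 - c)" using reals_Archimedean2 by blast
  then have n1: "1 < real n * (\<kappa>\<^sup>2 - c)" using c by (simp add: field_simps)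
  define u where "u j c' = replicate j i @ [c'] @ replicate (n - Suc j) 0" for j c'
  define X where "X j = B (e (replicate j i)) \<inter> (\<Inter>c'<i. B (e (u j c')))" for j
  have ri: "replicate j i \<in> words b" for j using i by (auto simp: words_def)
  have uw: "u j c' \<in> words b" if "c' < b" for j c' using that ri b by (auto simp: u_def words_def)
  have ulen: "length (u j c') = n" if "j < n" for j c' using that by (simp add: u_def)
  have X: "X j \<in> events \<and> \<kappa> \<le> prob (X j)" if "j < n" for j
  proof -
    obtain g where g: "g \<in> strong_emb b 0" "g [] = replicate j i" "\<And>c'. c' < b \<Longrightarrow> g [c'] = u j c'"
    proof (rule strong_emb_with_first_levels[of "replicate j i" b "u j" n])
      show "prefix (replicate j i @ [c']) (u j c')" for c' by (simp add: u_def)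
    qed (use ri uw ulen \<open>j < n\<close> in auto)
    have "X j = star_event B i (e \<circ> g)" using g(2,3) i by (simp add: X_def star_event_def)
    then show ?thesis using lam(2)[OF g(1)] star_event_events[OF B strong_emb_comp[OF e g(1)]] i by simp
  qed
  have "\<exists>j l. j < l \<and> l < n \<and> c < prob (X j \<inter> X l)"
  proof (rule ccontr)
    assume "\<nexists>j l. j < l \<and> l < n \<and> c < prob (X j \<inter> X l)"
    then have "prob (X j \<inter> X l) \<le> c" if "j < l" "l < n" for j l using that by (meson not_less)
    then have "real n * \<kappa>\<^sup>2 \<le> 1 + real n * c"
      using X lam(1) c(1) by (intro second_moment[of n X]) auto
    then show False using n1 by (simp add: algebra_simps)
  qed
  then obtain j l where jl: "j < l" "l < n" and big: "c < prob (X j \<inter> X l)" by blast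
  \<comment> \<open>the leaf in direction \<open>i\<close>, taken from the \<open>l\<close>-th star; a star without directions consists of its root
    only, and then \<open>i = 0\<close> and the root itself serves, in its own level\<close>
  define w where "w = (if i = 0 then replicate l 0 else u l 0)"
  define y where "y c' = (if c' < i then u j c' else if c' = i then w
    else replicate j i @ c' # replicate (length w - Suc j) 0)" for c'
  have w: "w \<in> words b" "prefix (replicate j i @ [i]) w" "i = 0 \<or> length w = n"
  proof -
    show "w \<in> words b" using uw[of 0 l] b by (auto simp: w_def words_def)
    have r: "replicate l i = replicate j i @ [i] @ replicate (l - Suc j) i"
      using jl(1) by (metis Suc_diff_Suc add_diff_inverse_nat append_Cons append_Nil less_imp_not_less replicate_Suc replicate_add)
    show "prefix (replicate j i @ [i]) w"
      using r by (cases "i = 0") (auto simp: w_def u_def prefix_def)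
    show "i = 0 \<or> length w = n" using ulen[OF jl(2)] by (simp add: w_def)
  qed
  have "Suc j \<le> length w" using prefix_length_le[OF w(2)] by simp
  obtain g where g: "g \<in> strong_emb b 0" "g [] = replicate j i" "\<And>c'. c' < b \<Longrightarrow> g [c'] = y c'"
  proof (rule strong_emb_with_first_levels[of "replicate j i" b y "length w"])
    fix c' assume c': "c' < b"
    show "y c' \<in> words b" using c' uw w(1) ri b by (auto simp: y_def words_def)
    show "prefix (replicate j i @ [c']) (y c')" using w(2) by (auto simp: y_def u_def)
    show "length (y c') = length w"
      using ulen[of j c'] jl w(3) \<open>Suc j \<le> length w\<close> by (auto simp: y_def)
  qed (use ri in auto)
  have "X j \<inter> X l \<subseteq> star_event B (Suc i) (e \<circ> g)"
  proof -
    have "star_event B (Suc i) (e \<circ> g) = X j \<inter> B (e w)"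
      using g(2,3) i by (auto simp: star_event_def X_def y_def lessThan_Suc)
    moreover have "X l \<subseteq> B (e w)" by (auto simp: X_def w_def)
    ultimately show ?thesis by blast
  qed
  then have "prob (X j \<inter> X l) \<le> prob (star_event B (Suc i) (e \<circ> g))"
    using star_event_events[OF B strong_emb_comp[OF e g(1)]] i by (intro finite_measure_mono) auto
  then show ?thesis using that[OF g(1)] big by linarith
qed

text \<open>
  Iterates the doubling step. After each step Milliken's theorem turns the existence of one good star into
  a bound for all stars of a strong subtree, which is the hypothesis of the next step.
\<close>
lemma star_lower_bound:
  assumes b: "0 < b" and B: "\<And>w. w \<in> words b \<Longrightarrow> B w \<in> events"
    and a: "0 < a" "\<And>w. w \<in> words b \<Longrightarrow> a \<le> prob (B w)"
    and "i \<le> b" "0 \<le> c" "c < a ^ (2 ^ i)"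
  obtains d where "d \<in> strong_emb b 0" "\<And>g. g \<in> strong_emb b 0 \<Longrightarrow> c \<le> prob (star_event B i (d \<circ> g))"
proof -
  have "\<exists>d\<in>strong_emb b 0. \<forall>g\<in>strong_emb b 0. c \<le> prob (star_event B i (d \<circ> g))"
    using assms(5-7)
  proof (induction i arbitrary: c)
    case 0
    have "c \<le> prob (star_event B 0 g)" if "g \<in> strong_emb b 0" for g
      using 0 a(2)[of "g []"] strong_emb_words[OF that, of "[]"] by (simp add: star_event_def)
    then show ?case by (intro bexI[of _ id]) auto
  next
    case (Suc i)
    have "sqrt c < a ^ 2 ^ i"
      using Suc.prems(3) a(1) by (intro real_less_lsqrt) (auto simp: power_mult[symmetric] mult.commute)
    then obtain \<kappa> where \<kappa>: "sqrt c < \<kappa>" "\<kappa> < a ^ 2 ^ i" using dense by blast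
    have \<kappa>0: "0 \<le> \<kappa>" using \<kappa>(1) Suc.prems(2) by (meson less_le_trans less_imp_le real_sqrt_ge_zero order_trans)
    have c: "c < \<kappa>\<^sup>2" using \<kappa>(1) Suc.prems(2) \<kappa>0 by (metis real_sqrt_less_iff real_sqrt_unique)
    from Suc.IH[OF Suc_leD[OF Suc.prems(1)] \<kappa>0 \<kappa>(2)] obtain e where e: "e \<in> strong_emb b 0"
      and el: "\<And>g. g \<in> strong_emb b 0 \<Longrightarrow> \<kappa> \<le> prob (star_event B i (e \<circ> g))"
      by blast
    define bad where "bad k f \<longleftrightarrow> k = 2 \<and> prob (star_event B (Suc i) (e \<circ> f)) < c" for k :: nat and f
    obtain d where d: "d \<in> strong_emb b 0" "\<And>g k. g \<in> strong_emb b 0 \<Longrightarrow> \<not> bad k (d \<circ> g)"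
    proof (rule milliken_closed[OF b, of bad])
      fix k f f' assume "\<And>w. w \<in> words b \<Longrightarrow> length w < k \<Longrightarrow> f w = (f' w :: nat list)"
      then show "bad k f = bad k f'"
        using star_event_cong[OF Suc.prems(1), of "e \<circ> f" "e \<circ> f'" B] by (auto simp: bad_def)
    next
      fix d assume d: "d \<in> strong_emb b 0"
      obtain g where "g \<in> strong_emb b 0" "c \<le> prob (star_event B (Suc i) (e \<circ> d \<circ> g))"
      proof (rule star_step[OF b B, where i = i and e = "e \<circ> d" and \<kappa> = \<kappa> and c = c])
        show "e \<circ> d \<in> strong_emb b 0" using e d by (rule strong_emb_comp)
        show "\<kappa> \<le> prob (star_event B i (e \<circ> d \<circ> g))" if "g \<in> strong_emb b 0" for g
          using el[OF strong_emb_comp[OF d that]] by (simp only: comp_assoc)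
      qed (use Suc.prems \<kappa>0 c in auto)
      then show "\<exists>g\<in>strong_emb b 0. \<forall>k. \<not> bad k (d \<circ> g)"
        unfolding bad_def comp_assoc by (intro bexI[of _ g]) (auto simp: not_less)
    qed blast
    have "c \<le> prob (star_event B (Suc i) (e \<circ> d \<circ> g))" if "g \<in> strong_emb b 0" for g
      using d(2)[OF that, of 2] unfolding bad_def comp_assoc by (simp only: not_less simp_thms)
    then show ?case using strong_emb_comp[OF e d(1)] by blast
  qed
  then show ?thesis using that by blast
qed

text \<open>
  The lower bound \<open>a\<close> is raised by factors \<open>\<rho>\<close> for as long as some strong subtree allows it; when none
  does, Milliken's theorem gives a strong subtree all of whose events stay below \<open>a * \<rho>\<close>.
\<close>
lemma almost_constant_probability:
  assumes b: "0 < b" and eps: "0 < \<epsilon>" "\<And>w. w \<in> words b \<Longrightarrow> \<epsilon> \<le> prob (B w)"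
    and \<rho>: "1 < \<rho>"
  obtains e a where "e \<in> strong_emb b 0" "\<epsilon> \<le> a" "\<And>w. w \<in> words b \<Longrightarrow> a \<le> prob (B (e w))"
    "\<And>w. w \<in> words b \<Longrightarrow> prob (B (e w)) < a * \<rho>"
proof -
  define J where "J = {j. \<exists>e\<in>strong_emb b 0. \<forall>w\<in>words b. \<epsilon> * \<rho> ^ j \<le> prob (B (e w))}"
  obtain N where N: "1 / \<epsilon> < \<rho> ^ N" using real_arch_pow[OF \<rho>] by blast
  have "j < N" if "j \<in> J" for j
  proof (rule ccontr)
    assume "\<not> j < N"
    then have "\<rho> ^ N \<le> \<rho> ^ j" using \<rho> by (intro power_increasing) auto
    then have "1 / \<epsilon> < \<rho> ^ j" using N by simp
    then have "1 < \<epsilon> * \<rho> ^ j" using eps(1) by (simp add: pos_divide_less_eq mult.commute)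
    moreover obtain e where "\<forall>w\<in>words b. \<epsilon> * \<rho> ^ j \<le> prob (B (e w))"
      using \<open>j \<in> J\<close> unfolding J_def by blast
    then have "\<epsilon> * \<rho> ^ j \<le> prob (B (e []))" by simp
    ultimately show False using prob_le_1[of "B (e [])"] by linarith
  qed
  then have "finite J" by (meson bounded_nat_set_is_finite)
  have "0 \<in> J" using eps(2) by (auto simp: J_def intro!: bexI[of _ id])
  define j where "j = Max J"
  have j: "j \<in> J" "Suc j \<notin> J"
  proof -
    show "j \<in> J" unfolding j_def using \<open>finite J\<close> \<open>0 \<in> J\<close> by (intro Max_in) auto
    show "Suc j \<notin> J" using Max_ge[OF \<open>finite J\<close>, of "Suc j"] unfolding j_def by auto
  qed
  obtain e where e: "e \<in> strong_emb b 0" "\<And>w. w \<in> words b \<Longrightarrow> \<epsilon> * \<rho> ^ j \<le> prob (B (e w))"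
    using j(1) by (auto simp: J_def)
  have translate: "\<exists>g\<in>strong_emb b 0. g [] = w" if "w \<in> words b" for w
    using strong_emb_with_first_levels[of w b "\<lambda>c. w @ [c]" "Suc (length w)"] that by auto
  define bad where "bad k f \<longleftrightarrow> k = 1 \<and> \<epsilon> * \<rho> ^ Suc j \<le> prob (B (e (f [])))"
    for k :: nat and f :: "nat list \<Rightarrow> nat list"
  obtain d where d: "d \<in> strong_emb b 0" "\<And>g k. g \<in> strong_emb b 0 \<Longrightarrow> \<not> bad k (d \<circ> g)"
  proof (rule milliken_closed[OF b, of bad])
    fix k f f' assume "\<And>w. w \<in> words b \<Longrightarrow> length w < k \<Longrightarrow> f w = (f' w :: nat list)"
    from this[of "[]"] show "bad k f = bad k f'" by (auto simp: bad_def)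
  next
    fix d assume d: "d \<in> strong_emb b 0"
    obtain w where w: "w \<in> words b" "\<not> \<epsilon> * \<rho> ^ Suc j \<le> prob (B (e (d w)))"
      using j(2) strong_emb_comp[OF e(1) d] unfolding J_def by auto
    obtain g where "g \<in> strong_emb b 0" "g [] = w" using translate w(1) by blast
    then show "\<exists>g\<in>strong_emb b 0. \<forall>k. \<not> bad k (d \<circ> g)"
      using w(2) by (intro bexI[of _ g]) (auto simp: bad_def)
  qed blast
  show ?thesis
  proof
    show "e \<circ> d \<in> strong_emb b 0" using e(1) d(1) by (rule strong_emb_comp)
    show "\<epsilon> \<le> \<epsilon> * \<rho> ^ j" using eps(1) \<rho> by simp
    fix w assume w: "w \<in> words b"
    show "\<epsilon> * \<rho> ^ j \<le> prob (B ((e \<circ> d) w))" using e(2) strong_emb_words[OF d(1) w] by simp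
    obtain g where "g \<in> strong_emb b 0" "g [] = w" using translate w by blast
    then show "prob (B ((e \<circ> d) w)) < \<epsilon> * \<rho> ^ j * \<rho>"
      using d(2)[of g 1] by (auto simp: bad_def mult_ac)
  qed
qed

text \<open>
  The exponent here is \<open>2 ^ b - 1\<close> and not \<open>2 ^ b\<close>: one factor \<open>a\<close> of the bound \<open>a ^ 2 ^ b\<close> for the star
  is absorbed by the probability of the event at its root, which is almost \<open>a\<close>.
\<close>
lemma star_conditional_bound:
  assumes b: "0 < b" and B: "\<And>w. w \<in> words b \<Longrightarrow> B w \<in> events"
    and eps: "\<And>w. w \<in> words b \<Longrightarrow> \<epsilon> \<le> prob (B w)" and \<tau>: "0 < \<tau>" "\<tau> < \<epsilon>"
  obtains e where "e \<in> strong_emb b 0" "\<And>g. g \<in> strong_emb b 0 \<Longrightarrow>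
     \<tau> ^ (2 ^ b - 1) * prob (B (e (g []))) \<le> prob (star_event B b (e \<circ> g))"
proof -
  define q :: nat where "q = 2 ^ b - 1"
  have q: "2 ^ b = Suc q" "0 < q" using b one_less_power[of "2::nat" b] by (auto simp: q_def)
  have "\<tau> ^ q < \<epsilon> ^ q" using \<tau> q(2) by (intro power_strict_mono) auto
  then have "1 < \<epsilon> ^ q / \<tau> ^ q" using \<tau> by simp
  \<comment> \<open>the gap between \<open>\<tau>\<close> and \<open>\<epsilon>\<close> leaves room for the fluctuation \<open>\<rho>\<close> of the probabilities\<close>
  then obtain \<rho> where \<rho>: "1 < \<rho>" "\<rho> < \<epsilon> ^ q / \<tau> ^ q" using dense by blast
  obtain e a where e: "e \<in> strong_emb b 0" and a: "\<epsilon> \<le> a" "\<And>w. w \<in> words b \<Longrightarrow> a \<le> prob (B (e w))"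
      "\<And>w. w \<in> words b \<Longrightarrow> prob (B (e w)) < a * \<rho>"
  proof (rule almost_constant_probability[OF b _ _ \<rho>(1), of \<epsilon> B])
    show "0 < \<epsilon>" using \<tau> by simp
  qed (use eps in blast)+
  have a0: "0 < a" using a(1) \<tau> by simp
  define c where "c = \<tau> ^ q * (a * \<rho>)"
  have "c = a * (\<rho> * \<tau> ^ q)" by (simp add: c_def)
  also have "\<dots> < a * \<epsilon> ^ q" using \<rho>(2) \<tau> a0 by (intro mult_strict_left_mono) (auto simp: field_simps)
  also have "\<dots> \<le> a * a ^ q" using a(1) \<tau> a0 by (intro mult_left_mono power_mono) auto
  finally have c: "c < a ^ (2 ^ b)" using q(1) by simp
  have "0 \<le> c" using \<tau> a0 \<rho>(1) by (simp add: c_def)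
  obtain d where d: "d \<in> strong_emb b 0" "\<And>g. g \<in> strong_emb b 0 \<Longrightarrow> c \<le> prob (star_event (B \<circ> e) b (d \<circ> g))"
    by (rule star_lower_bound[OF b _ a0 _ order_refl \<open>0 \<le> c\<close> c, of "B \<circ> e"])
      (use B strong_emb_words[OF e] a(2) in auto)
  show ?thesis
  proof
    show "e \<circ> d \<in> strong_emb b 0" using e d(1) by (rule strong_emb_comp)
    fix g assume g: "g \<in> strong_emb b 0"
    have "\<tau> ^ q * prob (B ((e \<circ> d) (g []))) \<le> c"
      unfolding c_def using a(3)[of "d (g [])"] strong_emb_words[OF strong_emb_comp[OF d(1) g], of "[]"] \<tau>
      by (intro mult_left_mono) auto
    also have "\<dots> \<le> prob (star_event (B \<circ> e) b (d \<circ> g))" by (rule d(2)[OF g])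
    also have "star_event (B \<circ> e) b (d \<circ> g) = star_event B b (e \<circ> d \<circ> g)" by (simp add: star_event_def)
    finally show "\<tau> ^ (2 ^ b - 1) * prob (B ((e \<circ> d) (g []))) \<le> prob (star_event B b (e \<circ> d \<circ> g))"
      by (simp add: q_def)
  qed
qed

text \<open>
  The measure-theoretic core. The embedding is built level by level, each new factor being a thinning
  beyond the levels already fixed. Once \<open>m\<close> levels are fixed, \<open>E m f\<close> is their joint event and
  \<open>L m f s\<close> the joint event of the nodes that continue all cones above level \<open>m\<close> by the same word \<open>s\<close>.
  The invariant is that each \<open>L m f s\<close> has conditional probability at least \<open>\<tau> m ^ q ^ m\<close> given \<open>E m f\<close>.
  Applied to the family \<open>L m f\<close> under the conditional measure, \<open>star_conditional_bound\<close> yields the next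
  level and the next invariant, because the events of the next level are stars without their root.
\<close>
lemma strong_emb_initial_segments:
  assumes b: "0 < b" and A: "\<And>w. w \<in> words b \<Longrightarrow> A w \<in> events"
    and eps: "\<And>w. w \<in> words b \<Longrightarrow> \<epsilon> \<le> prob (A w)" and \<theta>: "0 < \<theta>" "\<theta> < \<epsilon>"
  obtains g where "g \<in> strong_emb b 0"
    "\<And>k. 1 \<le> k \<Longrightarrow> \<theta> ^ (\<Sum>j<k. (2 ^ b - 1) ^ j) \<le> prob (\<Inter>w\<in>{w \<in> words b. length w < k}. A (g w))"
proof -
  define q :: nat where "q = 2 ^ b - 1"
  \<comment> \<open>any sequence that decreases strictly from \<open>\<epsilon>\<close> and stays above \<open>\<theta>\<close> would do\<close>
  define \<tau> where "\<tau> n = \<theta> + (\<epsilon> - \<theta>) / 2 ^ n" for n :: nat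
  have \<tau>: "\<theta> < \<tau> n" "\<tau> (Suc n) < \<tau> n" "0 < \<tau> n" for n
  proof -
    show less: "\<theta> < \<tau> n" using \<theta> by (simp add: \<tau>_def)
    show "\<tau> (Suc n) < \<tau> n" using \<theta> by (simp add: \<tau>_def field_simps)
    show "0 < \<tau> n" using less \<theta> by simp
  qed
  let ?V = "words_of_length b"
  define E where "E m f = space M \<inter> (\<Inter>w\<in>{w \<in> words b. length w < m}. A (f w))" for m f
  define L where "L m f s = (\<Inter>v\<in>?V m. A (f (v @ s)))" for m f s
  have E_events: "E m f \<in> events" if "f \<in> strong_emb b 0" for m f
  proof (cases "{w \<in> words b. length w < m} = {}")
    case False
    then show ?thesis unfolding E_def
      using finite_words_below A strong_emb_words[OF that] by (intro sets.Int sets.top sets.finite_INT) auto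
  next
    case True
    show ?thesis unfolding E_def True by simp
  qed
  have L_events: "L m f s \<in> events" if "f \<in> strong_emb b 0" "s \<in> words b" for m f s
    unfolding L_def
  proof (rule sets.finite_INT[OF finite_words_of_length words_of_length_nonempty[OF b]])
    fix v assume "v \<in> ?V m"
    then have "v @ s \<in> words b" using that(2) by (simp add: words_of_length_def)
    then show "A (f (v @ s)) \<in> events" using A strong_emb_words[OF that(1)] by blast
  qed
  define Inv where "Inv m f \<longleftrightarrow> f \<in> strong_emb b 0 \<and> 0 < prob (E m f) \<and>
    (\<forall>s\<in>words b. \<tau> m ^ (q ^ m) * prob (E m f) \<le> prob (E m f \<inter> L m f s))" for m f
  have step: "\<exists>d\<in>strong_emb b m. Inv (Suc m) (f \<circ> d) \<and> \<tau> m ^ (q ^ m) * prob (E m f) \<le> prob (E (Suc m) (f \<circ> d))"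
    if Inv: "Inv m f" for m f
  proof -
    have f: "f \<in> strong_emb b 0" and pos: "0 < prob (E m f)"
      and big: "\<And>s. s \<in> words b \<Longrightarrow> \<tau> m ^ (q ^ m) * prob (E m f) \<le> prob (E m f \<inter> L m f s)"
      using Inv by (auto simp: Inv_def)
    define N where "N = uniform_measure M (E m f)"
    have emE: "emeasure M (E m f) \<noteq> 0" "emeasure M (E m f) \<noteq> \<infinity>"
      using pos by (auto simp: emeasure_eq_measure)
    interpret N: prob_space N unfolding N_def using emE by (rule prob_space_uniform_measure)
    have N: "N.prob X = prob (E m f \<inter> X) / prob (E m f)" if "X \<in> events" for X
      unfolding N_def using emE that by (rule measure_uniform_measure)
    have sets_N: "N.events = events" by (simp add: N_def)
    obtain e where e: "e \<in> strong_emb b 0" and star: "\<And>g. g \<in> strong_emb b 0 \<Longrightarrow>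
       (\<tau> (Suc m) ^ (q ^ m)) ^ (2 ^ b - 1) * N.prob (L m f (e (g []))) \<le> N.prob (star_event (L m f) b (e \<circ> g))"
    proof (rule N.star_conditional_bound[OF b, of "L m f" "\<tau> m ^ (q ^ m)" "\<tau> (Suc m) ^ (q ^ m)"])
      show "L m f w \<in> N.events" if "w \<in> words b" for w using L_events[OF f that] by (simp add: sets_N)
      show "\<tau> m ^ q ^ m \<le> N.prob (L m f w)" if "w \<in> words b" for w
        unfolding N[OF L_events[OF f that]] using big[OF that] pos by (simp add: pos_le_divide_eq)
      show "\<tau> (Suc m) ^ q ^ m < \<tau> m ^ q ^ m"
        using \<tau>(2)[of m] \<tau>(3)[of "Suc m"] b one_less_power[of "2::nat" b]
        by (intro power_strict_mono) (auto simp: q_def)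
      show "0 < \<tau> (Suc m) ^ q ^ m" using \<tau>(3) by simp
    qed blast
    define d where "d = tail_map b m (\<lambda>v. e)"
    have d: "d \<in> strong_emb b m" unfolding d_def
      by (rule tail_map_strong_emb) (auto intro: strong_emb_words[OF e] strong_emb_length_eq[OF e] strong_emb_succ[OF e])
    have fd: "f \<circ> d \<in> strong_emb b 0" using f strong_emb_0[OF d] by (rule strong_emb_comp)
    have e_words: "e s \<in> words b" if "s \<in> words b" for s using that by (rule strong_emb_words[OF e])
    have E_Suc: "E (Suc m) (f \<circ> d) = E m f \<inter> L m f (e [])"
    proof -
      have "{w \<in> words b. length w < Suc m} = {w \<in> words b. length w < m} \<union> ?V m"
        by (auto simp: words_of_length_def)
      moreover have "f (d w) = f w" if "w \<in> words b" "length w < m" for w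
        using strong_emb_fixed[OF d that] by simp
      moreover have "d v = v @ e []" if "v \<in> ?V m" for v
        using tail_map_append[OF that, of "[]"] by (simp add: d_def)
      ultimately show ?thesis by (auto simp: E_def L_def)
    qed
    have L_Suc: "L (Suc m) (f \<circ> d) s = (\<Inter>c<b. L m f (e (c # s)))" if s: "s \<in> words b" for s
    proof -
      have V: "?V (Suc m) = (\<lambda>(v, c). v @ [c]) ` (?V m \<times> {..<b})"
      proof (intro equalityI subsetI)
        fix w assume "w \<in> ?V (Suc m)"
        then show "w \<in> (\<lambda>(v, c). v @ [c]) ` (?V m \<times> {..<b})"
          by (cases w rule: rev_cases) (auto simp: words_of_length_def)
      qed (auto simp: words_of_length_def)
      have "d (v @ c # s) = v @ e (c # s)" if "v \<in> ?V m" "c < b" for v c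
        using tail_map_append[OF that(1), of "c # s"] that(2) s by (simp add: d_def)
      then show ?thesis by (auto simp: L_def V)
    qed
    have "Inv (Suc m) (f \<circ> d)"
      unfolding Inv_def
    proof (intro conjI ballI fd)
      have "0 < \<tau> m ^ (q ^ m) * prob (E m f)" using pos \<tau>(3) by simp
      then show "0 < prob (E (Suc m) (f \<circ> d))"
        unfolding E_Suc using big[OF e_words[of "[]"]] by simp
      fix s assume s: "s \<in> words b"
      obtain g where g: "g \<in> strong_emb b 0" "g [] = []" "\<And>c. c < b \<Longrightarrow> g [c] = c # s"
        using strong_emb_with_first_levels[of "[]" b "\<lambda>c. c # s" "Suc (length s)"] s by auto
      have "star_event (L m f) b (e \<circ> g) = L m f (e []) \<inter> L (Suc m) (f \<circ> d) s"
        using g(2,3) by (simp add: star_event_def L_Suc[OF s])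
      then have "(\<tau> (Suc m) ^ (q ^ m)) ^ q * N.prob (L m f (e []))
          \<le> N.prob (L m f (e []) \<inter> L (Suc m) (f \<circ> d) s)"
        using star[OF g(1)] g(2) by (simp add: q_def)
      then have "(\<tau> (Suc m) ^ (q ^ m)) ^ q * prob (E m f \<inter> L m f (e []))
          \<le> prob (E m f \<inter> (L m f (e []) \<inter> L (Suc m) (f \<circ> d) s))"
        using pos L_events[OF f e_words] L_events[OF fd s]
        by (simp add: N sets.Int divide_le_cancel)
      then show "\<tau> (Suc m) ^ (q ^ Suc m) * prob (E (Suc m) (f \<circ> d))
          \<le> prob (E (Suc m) (f \<circ> d) \<inter> L (Suc m) (f \<circ> d) s)"
        unfolding E_Suc by (simp add: power_mult[symmetric] mult.commute[of q] Int_assoc)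
    qed
    moreover have "\<tau> m ^ (q ^ m) * prob (E m f) \<le> prob (E (Suc m) (f \<circ> d))"
      unfolding E_Suc by (rule big[OF e_words]) simp
    ultimately show ?thesis using d by blast
  qed
  define pick where "pick m f = (SOME d. d \<in> strong_emb b m \<and> Inv (Suc m) (f \<circ> d) \<and>
    \<tau> m ^ (q ^ m) * prob (E m f) \<le> prob (E (Suc m) (f \<circ> d)))" for m f
  have pick: "pick m f \<in> strong_emb b m" "Inv (Suc m) (f \<circ> pick m f)"
      "\<tau> m ^ (q ^ m) * prob (E m f) \<le> prob (E (Suc m) (f \<circ> pick m f))" if "Inv m f" for m f
    using someI_ex[OF step[OF that, unfolded Bex_def]] unfolding pick_def by blast+
  define fs where "fs = rec_nat id (\<lambda>m f. f \<circ> pick m f)"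
  have fs_0: "fs 0 = id" and fs_Suc: "fs (Suc m) = fs m \<circ> pick m (fs m)" for m by (simp_all add: fs_def)
  have Inv: "Inv m (fs m)" for m
  proof (induction m)
    case 0
    have V: "?V 0 = {[]}" by (auto simp: words_of_length_def)
    have E: "E 0 id = space M" by (simp add: E_def)
    have L: "E 0 id \<inter> L 0 id s = A s" if "s \<in> words b" for s
      unfolding E L_def V using sets.sets_into_space[OF A[OF that]] by auto
    show ?case unfolding Inv_def fs_0
    proof (intro conjI ballI)
      show "0 < prob (E 0 id)" unfolding E prob_space by simp
      fix s assume s: "s \<in> words b"
      show "\<tau> 0 ^ (q ^ 0) * prob (E 0 id) \<le> prob (E 0 id \<inter> L 0 id s)"
        unfolding L[OF s] unfolding E prob_space using eps[OF s] by (simp add: \<tau>_def)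
    qed (rule id_strong_emb)
  next
    case (Suc m)
    show ?case unfolding fs_Suc by (rule pick(2)[OF Suc])
  qed
  obtain D where D: "\<And>m. D m \<in> strong_emb b m" "\<And>m. D m = pick m (fs m) \<circ> D (Suc m)"
    using infinite_composition[of "\<lambda>m. pick m (fs m)" b] pick(1)[OF Inv] by blast
  have fsD: "D 0 = fs m \<circ> D m" for m
  proof (induction m)
    case (Suc m)
    show ?case unfolding fs_Suc comp_assoc D(2)[symmetric] by (rule Suc)
  qed (simp add: fs_0)
  have lower: "\<theta> ^ (\<Sum>j<m. q ^ j) \<le> prob (E m (fs m))" for m
  proof (induction m)
    case 0
    then show ?case by (simp add: E_def prob_space)
  next
    case (Suc m)
    have "\<theta> ^ (\<Sum>j<Suc m. q ^ j) = \<theta> ^ (q ^ m) * \<theta> ^ (\<Sum>j<m. q ^ j)" by (simp add: power_add mult.commute)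
    also have "\<dots> \<le> \<tau> m ^ (q ^ m) * prob (E m (fs m))"
      using \<tau>(1,3)[of m] \<theta> Suc by (intro mult_mono power_mono) auto
    also have "\<dots> \<le> prob (E (Suc m) (fs (Suc m)))" unfolding fs_Suc by (rule pick(3)[OF Inv])
    finally show ?case .
  qed
  have "\<theta> ^ (\<Sum>j<k. q ^ j) \<le> prob (\<Inter>w\<in>{w \<in> words b. length w < k}. A (D 0 w))" if "1 \<le> k" for k
  proof -
    have "D 0 w = fs k w" if "w \<in> words b" "length w < k" for w
      unfolding fsD[of k] using strong_emb_fixed[OF D(1) that] by simp
    then have "(\<Inter>w\<in>{w \<in> words b. length w < k}. A (D 0 w)) = (\<Inter>w\<in>{w \<in> words b. length w < k}. A (fs k w))"
      by simp
    also have "\<dots> = E k (fs k)"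
    proof -
      have "fs k [] \<in> words b" using Inv[of k] strong_emb_words[of "fs k" b 0 "[]"] by (simp add: Inv_def)
      then have "A (fs k []) \<subseteq> space M" using sets.sets_into_space A by blast
      moreover have "[] \<in> {w \<in> words b. length w < k}" using that by simp
      ultimately show ?thesis unfolding E_def by blast
    qed
    finally show ?thesis using lower[of k] by simp
  qed
  then show ?thesis using that[OF D(1)] by (simp add: q_def)
qed

end

section \<open>Homogeneous trees as trees of words\<close>

text \<open>
  An isomorphism from the tree of words onto its image.
\<close>
definition labelling :: "('a \<Rightarrow> 'a \<Rightarrow> bool) \<Rightarrow> nat \<Rightarrow> (nat list \<Rightarrow> 'a) \<Rightarrow> bool" where
  "labelling lt b \<phi> \<longleftrightarrow> inj_on \<phi> (words b) \<and>
     (\<forall>u\<in>words b. \<forall>w\<in>words b. lt (\<phi> u) (\<phi> w) \<longleftrightarrow> strict_prefix u w)"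

lemma labelling_lt:
  "labelling lt b \<phi> \<Longrightarrow> u \<in> words b \<Longrightarrow> w \<in> words b \<Longrightarrow> lt (\<phi> u) (\<phi> w) \<longleftrightarrow> strict_prefix u w"
  and labelling_eq:
  "labelling lt b \<phi> \<Longrightarrow> u \<in> words b \<Longrightarrow> w \<in> words b \<Longrightarrow> \<phi> u = \<phi> w \<longleftrightarrow> u = w"
  by (auto simp: labelling_def inj_on_def)

lemma prefix_in_words: "prefix u w \<Longrightarrow> w \<in> words b \<Longrightarrow> u \<in> words b"
  by (auto simp: prefix_def)

lemma labelling_below:
  assumes \<phi>: "labelling lt b \<phi>" and w: "w \<in> words b" and R: "R \<subseteq> \<phi> ` words b"
  shows "{s \<in> R. lt s (\<phi> w)} = \<phi> ` {u. strict_prefix u w \<and> \<phi> u \<in> R}"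
proof (intro equalityI subsetI)
  fix s assume s: "s \<in> {s \<in> R. lt s (\<phi> w)}"
  then obtain u where "u \<in> words b" "s = \<phi> u" using R by blast
  then show "s \<in> \<phi> ` {u. strict_prefix u w \<and> \<phi> u \<in> R}"
    using s labelling_lt[OF \<phi> _ w] by auto
next
  fix s assume "s \<in> \<phi> ` {u. strict_prefix u w \<and> \<phi> u \<in> R}"
  then obtain u where u: "s = \<phi> u" "strict_prefix u w" "\<phi> u \<in> R" by blast
  then have "u \<in> words b" using w prefix_in_words by (auto simp: strict_prefix_def)
  then show "s \<in> {s \<in> R. lt s (\<phi> w)}" using u labelling_lt[OF \<phi> _ w] by auto
qed

lemma labelling_node_length:
  assumes \<phi>: "labelling lt b \<phi>" and w: "w \<in> words b" and R: "R \<subseteq> \<phi> ` words b"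
  shows "node_length lt R (\<phi> w) = card {u. strict_prefix u w \<and> \<phi> u \<in> R}"
proof -
  have "inj_on \<phi> {u. strict_prefix u w \<and> \<phi> u \<in> R}"
    by (rule inj_onI) (use labelling_eq[OF \<phi>] prefix_in_words[OF _ w] in \<open>auto simp: strict_prefix_def\<close>)
  then show ?thesis
    unfolding node_length_def labelling_below[OF assms] by (rule card_image)
qed

lemma strict_prefixes_take: "{u. strict_prefix u w} = (\<lambda>n. take n w) ` {..<length w}"
proof (intro equalityI subsetI)
  fix u assume "u \<in> {u. strict_prefix u w}"
  then have u: "prefix u w" "length u < length w" by (auto simp: prefix_length_less strict_prefix_def)
  then have "u = take (length u) w" by (auto simp: prefix_def)
  then show "u \<in> (\<lambda>n. take n w) ` {..<length w}" using u(2) by blast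
qed (auto simp: strict_prefix_def take_is_prefix)

lemma finite_strict_prefixes: "finite {u. strict_prefix u w}"
  unfolding strict_prefixes_take by simp

lemma card_strict_prefixes: "card {u. strict_prefix u w} = length w"
proof -
  have "inj_on (\<lambda>n. take n w) {..<length w}"
    by (rule inj_onI) (metis length_take lessThan_iff min.absorb4)
  then show ?thesis by (simp add: strict_prefixes_take card_image)
qed

lemma labelling_node_length_full:
  assumes \<phi>: "labelling lt b \<phi>" and w: "w \<in> words b"
  shows "node_length lt (\<phi> ` words b) (\<phi> w) = length w"
proof -
  have "{u. strict_prefix u w \<and> \<phi> u \<in> \<phi> ` words b} = {u. strict_prefix u w}"
    using prefix_in_words[OF _ w] by (auto simp: strict_prefix_def)
  then show ?thesis
    using labelling_node_length[OF assms, of "\<phi> ` words b"] by (simp add: card_strict_prefixes)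
qed

lemma labelling_imm_succ_full:
  assumes \<phi>: "labelling lt b \<phi>" and w: "w \<in> words b"
  shows "imm_succ lt (\<phi> ` words b) (\<phi> w) = (\<lambda>c. \<phi> (w @ [c])) ` {..<b}"
proof (intro equalityI subsetI)
  fix s assume s: "s \<in> imm_succ lt (\<phi> ` words b) (\<phi> w)"
  then obtain v where v: "v \<in> words b" "s = \<phi> v" by (auto simp: imm_succ_def)
  then have "length v = length w + 1"
    using s w by (simp add: imm_succ_def labelling_node_length_full[OF \<phi>])
  moreover have "prefix w v"
    using s v w labelling_lt[OF \<phi> w v(1)] labelling_eq[OF \<phi> w v(1)] by (auto simp: imm_succ_def strict_prefix_def)
  ultimately obtain z where "v = w @ z" "length z = Suc 0" by (auto simp: prefix_def)
  then obtain c where "v = w @ [c]" by (auto simp: length_Suc_conv)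
  then show "s \<in> (\<lambda>c. \<phi> (w @ [c])) ` {..<b}" using v by auto
next
  fix s assume "s \<in> (\<lambda>c. \<phi> (w @ [c])) ` {..<b}"
  then obtain c where c: "c < b" "s = \<phi> (w @ [c])" by blast
  then show "s \<in> imm_succ lt (\<phi> ` words b) (\<phi> w)"
    using w labelling_lt[OF \<phi> w, of "w @ [c]"]
    by (simp add: imm_succ_def labelling_node_length_full[OF \<phi>] strict_prefix_def)
qed

lemma labelling_comp_strong_emb:
  assumes \<phi>: "labelling lt b \<phi>" and e: "e \<in> strong_emb b m"
  shows "labelling lt b (\<phi> \<circ> e)"
proof -
  have iff: "strict_prefix (e u) (e w) \<longleftrightarrow> strict_prefix u w" if uw: "u \<in> words b" "w \<in> words b" for u w
  proof
    assume "strict_prefix u w"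
    then obtain c v where "w = u @ c # v" by (auto elim: strict_prefixE')
    then have "prefix (e u @ [c]) (e w)" using strong_emb_prefix[OF e, of u c v] uw by simp
    then show "strict_prefix (e u) (e w)" by (auto simp: prefix_def strict_prefix_def)
  next
    assume *: "strict_prefix (e u) (e w)"
    then have "length (e u) < length (e w)" by (rule prefix_length_less)
    then have less: "length u < length w"
      using strong_emb_length_eq[OF e uw] strong_emb_length_less[OF e uw(2,1)] by (metis less_asym linorder_neqE_nat less_irrefl)
    let ?u = "take (length u) w"
    have u': "?u \<in> words b" "length ?u = length u" using uw less by (auto simp: take_in_words)
    have "prefix (e ?u) (e w)"
      using strong_emb_prefix_mono[OF e, of ?u "drop (length u) w"] uw by simp
    moreover have "length (e ?u) = length (e u)" by (rule strong_emb_length_eq[OF e u'(1) uw(1) u'(2)])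
    ultimately have "e ?u = e u"
      using * by (auto simp: strict_prefix_def prefix_def)
    then have "?u = u" by (rule strong_emb_inj[OF e u'(1) uw(1) u'(2)])
    then show "strict_prefix u w" using less by (metis strict_prefix_def take_is_prefix less_irrefl)
  qed
  moreover have "u = w" if "u \<in> words b" "w \<in> words b" "e u = e w" for u w
    using that strong_emb_inj[OF e that(1,2)] strong_emb_length_less[OF e that(1,2)] strong_emb_length_less[OF e that(2,1)]
    by (metis less_irrefl linorder_neqE_nat)
  ultimately show ?thesis
    using strong_emb_words[OF e] \<phi> unfolding labelling_def inj_on_def by auto
qed

lemma labelling_infinite_height:
  assumes \<phi>: "labelling lt b \<phi>" and b: "0 < b"
  shows "tree_height lt (\<phi> ` words b) = \<infinity>"
proof -
  have "\<phi> (replicate n 0) \<in> tree_level lt (\<phi> ` words b) n" for n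
  proof -
    have "replicate n 0 \<in> words b" using b by (auto simp: words_def)
    then show ?thesis by (simp add: tree_level_def labelling_node_length_full[OF \<phi>])
  qed
  then show ?thesis by (auto simp: tree_height_def)
qed

lemma labelling_level:
  assumes \<phi>: "labelling lt b \<phi>"
  shows "tree_level lt (\<phi> ` words b) n = \<phi> ` words_of_length b n"
  using labelling_node_length_full[OF \<phi>] by (auto simp: tree_level_def words_of_length_def)

text \<open>
  A finite chain has a longest word \<open>w\<close> (the root if it is empty), and a successor of \<open>w\<close> extends it.
\<close>
lemma labelling_maxchain_infinite:
  assumes \<phi>: "labelling lt b \<phi>" and b: "0 < b"
    and C: "pred_on.maxchain (\<phi> ` words b) lt C"
  shows "infinite C"
proof
  assume fin: "finite C"
  let ?A = "\<phi> ` words b"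
  have ch: "C \<subseteq> ?A" "\<And>x y. x \<in> C \<Longrightarrow> y \<in> C \<Longrightarrow> lt\<^sup>=\<^sup>= x y \<or> lt\<^sup>=\<^sup>= y x"
    using C by (auto simp: pred_on.maxchain_def pred_on.chain_def)
  have "finite (words b \<inter> \<phi> -` C)"
    by (rule finite_subset[OF _ finite_vimage_IntI[OF fin, of \<phi> "words b"]]) (use \<phi> in \<open>auto simp: labelling_def\<close>)
  define N where "N = insert [] (words b \<inter> \<phi> -` C)"
  have N: "finite N" "N \<noteq> {}" using \<open>finite (words b \<inter> \<phi> -` C)\<close> by (auto simp: N_def)
  have "Max (length ` N) \<in> length ` N" using N by (intro Max_in) auto
  then obtain w where w1: "w \<in> N" "Max (length ` N) = length w" by blast
  have "length v \<le> Max (length ` N)" if "v \<in> N" for v using that N by simp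
  then have w: "w \<in> N" "\<And>v. v \<in> N \<Longrightarrow> length v \<le> length w" using w1 by auto
  have ww: "w \<in> words b" using w(1) by (auto simp: N_def)
  have "prefix v w" if v: "v \<in> words b" "\<phi> v \<in> C" for v
  proof (cases "w = []")
    case True
    then show ?thesis using w(2)[of v] v by (auto simp: N_def)
  next
    case False
    then have "\<phi> w \<in> C" using w(1) by (auto simp: N_def)
    then have "prefix v w \<or> prefix w v"
      using ch(2)[OF v(2)] labelling_lt[OF \<phi>] labelling_eq[OF \<phi>] v ww by (fastforce simp: strict_prefix_def)
    then show ?thesis using w(2)[of v] v by (auto simp: N_def prefix_def)
  qed
  let ?x = "\<phi> (w @ [0])"
  have below: "lt s ?x" if "s \<in> C" for s
  proof -
    obtain v where v: "v \<in> words b" "s = \<phi> v" using \<open>s \<in> C\<close> ch(1) by blast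
    then have "prefix v w" using \<open>\<And>v. v \<in> words b \<Longrightarrow> \<phi> v \<in> C \<Longrightarrow> prefix v w\<close> that by blast
    then have "strict_prefix v (w @ [0])" by (auto simp: strict_prefix_def prefix_def)
    then show ?thesis using labelling_lt[OF \<phi> v(1), of "w @ [0]"] ww b v(2) by simp
  qed
  have "pred_on.chain ?A lt (insert ?x C)"
    unfolding pred_on.chain_def using ch below ww b by auto
  moreover have "C \<subset> insert ?x C"
  proof -
    have "\<not> lt ?x ?x" using labelling_lt[OF \<phi>, of "w @ [0]" "w @ [0]"] ww b by simp
    then have "?x \<notin> C" using below by blast
    then show ?thesis by blast
  qed
  ultimately show False using C by (auto simp: pred_on.maxchain_def)
qed

lemma countable_words: "countable (words b)"
  by (rule countableI_type)

text \<open>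
  The image of a strong embedding is a strong subtree. It is balanced since its maximal chains are infinite
  and countable.
\<close>
lemma labelling_strong_subtree:
  assumes \<phi>: "labelling lt b \<phi>" and e: "e \<in> strong_emb b m" and b: "0 < b"
  shows "strong_subtree lt (\<phi> ` words b) ((\<phi> \<circ> e) ` words b)"
proof -
  let ?\<psi> = "\<phi> \<circ> e"
  have \<psi>: "labelling lt b ?\<psi>" using \<phi> e by (rule labelling_comp_strong_emb)
  have sub: "?\<psi> ` words b \<subseteq> \<phi> ` words b" using strong_emb_words[OF e] by auto
  have "words_of_length b 0 = {[]}" by (auto simp: words_of_length_def)
  then have "uniquely_rooted lt (?\<psi> ` words b)"
    unfolding uniquely_rooted_def labelling_level[OF \<psi>] by simp
  moreover have "balanced_tree lt (?\<psi> ` words b)"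
    unfolding balanced_tree_def
  proof (intro allI impI)
    fix C D assume CD: "pred_on.maxchain (?\<psi> ` words b) lt C" "pred_on.maxchain (?\<psi> ` words b) lt D"
    have "C \<approx> (UNIV :: nat set)" if "pred_on.maxchain (?\<psi> ` words b) lt C" for C
    proof -
      have "infinite C" using \<psi> b that by (rule labelling_maxchain_infinite)
      moreover have "countable C"
        using that countable_words[of b] by (meson countable_image countable_subset pred_on.chain_def pred_on.maxchain_def)
      ultimately show ?thesis
        using countableE_infinite[of C] by (metis eqpoll_def)
    qed
    then show "C \<approx> D" using CD by (meson eqpoll_sym eqpoll_trans)
  qed
  moreover have "\<exists>k. tree_level lt (?\<psi> ` words b) n \<subseteq> tree_level lt (\<phi> ` words b) k" for n
  proof -
    have r: "replicate n 0 \<in> words b" using b by (auto simp: words_def)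
    have "e v \<in> words_of_length b (length (e (replicate n 0)))" if "v \<in> words_of_length b n" for v
      using that strong_emb_words[OF e, of v] strong_emb_length_eq[OF e _ r, of v] by (auto simp: words_of_length_def)
    then show ?thesis unfolding labelling_level[OF \<phi>] labelling_level[OF \<psi>] by auto
  qed
  moreover have "\<exists>!s'. s' \<in> imm_succ lt (?\<psi> ` words b) s \<and> lt\<^sup>=\<^sup>= t s'"
    if s: "s \<in> ?\<psi> ` words b" and t: "t \<in> imm_succ lt (\<phi> ` words b) s" for s t
  proof -
    obtain w where w: "w \<in> words b" "s = \<phi> (e w)" using s by auto
    have ew: "e w \<in> words b" using w(1) by (rule strong_emb_words[OF e])
    obtain c where c: "c < b" "t = \<phi> (e w @ [c])"
      using t unfolding w(2) labelling_imm_succ_full[OF \<phi> ew] by blast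
    have imm: "imm_succ lt (?\<psi> ` words b) s = (\<lambda>c. ?\<psi> (w @ [c])) ` {..<b}"
      using labelling_imm_succ_full[OF \<psi> w(1)] w(2) by simp
    have le: "lt\<^sup>=\<^sup>= t (?\<psi> (w @ [c'])) \<longleftrightarrow> c' = c" if "c' < b" for c'
    proof -
      have ecw: "e (w @ [c']) \<in> words b" using w(1) that by (intro strong_emb_words[OF e]) simp
      have "lt\<^sup>=\<^sup>= t (?\<psi> (w @ [c'])) \<longleftrightarrow> prefix (e w @ [c]) (e (w @ [c']))"
        using labelling_lt[OF \<phi> _ ecw, of "e w @ [c]"] labelling_eq[OF \<phi> _ ecw, of "e w @ [c]"] ew c
        by (auto simp: strict_prefix_def)
      also have "\<dots> \<longleftrightarrow> c' = c"
        using strong_emb_succ[OF e w(1) that] by (auto simp: prefix_def)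
      finally show ?thesis .
    qed
    show ?thesis unfolding imm
      by (rule ex1I[of _ "?\<psi> (w @ [c])"]) (use le c(1) in auto)
  qed
  ultimately show ?thesis using sub by (auto simp: strong_subtree_def)
qed

text \<open>
  The labelling reads a word as a path from the root, after the successors of each node have been
  enumerated. It is onto because a node of length \<open>n\<close> has predecessors of all smaller lengths, the
  node preceding it directly being its predecessor of maximal length.
\<close>
lemma homogeneous_tree_labelling:
  assumes T: "homogeneous_tree lt T b"
  obtains \<phi> where "labelling lt b \<phi>" "\<phi> ` words b = T"
proof -
  have tree: "irreflp_on T lt" "transp_on T lt" "\<And>t. t \<in> T \<Longrightarrow> finite {s \<in> T. lt s t}"
      "\<And>t. t \<in> T \<Longrightarrow> totalp_on {s \<in> T. lt s t} lt"
    and root: "card (tree_level lt T 0) = 1" and succ: "\<And>t. t \<in> T \<Longrightarrow> card (imm_succ lt T t) = b"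
    and b: "b \<ge> 2"
    using T by (auto simp: homogeneous_tree_def tree_on_def uniquely_rooted_def)
  obtain r where r: "tree_level lt T 0 = {r}" using root by (auto simp: card_1_singleton_iff)
  have "\<exists>f. bij_betw f {..<b} (imm_succ lt T t)" if "t \<in> T" for t
    using ex_bij_betw_nat_finite[of "imm_succ lt T t"] succ[OF that] b
    by (metis atLeast0LessThan card.infinite not_numeral_le_zero)
  then obtain f where f: "\<And>t. t \<in> T \<Longrightarrow> bij_betw (f t) {..<b} (imm_succ lt T t)" by metis
  define \<phi> where "\<phi> = foldl f r"
  have \<phi>_Nil: "\<phi> [] = r" and \<phi>_snoc: "\<phi> (w @ [c]) = f (\<phi> w) c" for w c by (simp_all add: \<phi>_def)
  have lenT: "node_length lt T s = card {u \<in> T. lt u s}" for s by (simp add: node_length_def)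
  have length_less: "node_length lt T x < node_length lt T y" if "x \<in> T" "y \<in> T" "lt x y" for x y
  proof -
    have "{s \<in> T. lt s x} \<subset> {s \<in> T. lt s y}"
      using that tree(1) transp_onD[OF tree(2), of _ x y] by (auto simp: irreflp_on_def)
    then show ?thesis unfolding lenT by (rule psubset_card_mono[OF tree(3)[OF that(2)]])
  qed
  have step: "f t c \<in> T \<and> node_length lt T (f t c) = Suc (node_length lt T t) \<and> lt t (f t c)"
    if "t \<in> T" "c < b" for t c
    using bij_betwE[OF f[OF that(1)]] that(2) by (auto simp: imm_succ_def)
  have \<phi>T: "\<phi> w \<in> T \<and> node_length lt T (\<phi> w) = length w" if "w \<in> words b" for w
    using that
  proof (induction w rule: rev_induct)
    case Nil
    have "r \<in> tree_level lt T 0" using r by simp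
    then show ?case by (simp add: \<phi>_Nil tree_level_def)
  next
    case (snoc c w)
    then show ?case using step[of "\<phi> w" c] by (simp add: \<phi>_snoc)
  qed
  have mono: "lt (\<phi> u) (\<phi> w)" if "strict_prefix u w" "w \<in> words b" for u w
  proof -
    obtain c v where w: "w = u @ c # v" using \<open>strict_prefix u w\<close> by (auto elim: strict_prefixE')
    have "u @ c # v \<in> words b" using that(2) w by simp
    then have "lt (\<phi> u) (\<phi> (u @ c # v))"
    proof (induction v rule: rev_induct)
      case Nil
      then show ?case using step[of "\<phi> u" c] \<phi>T by (simp add: \<phi>_snoc)
    next
      case (snoc d v)
      have *: "\<phi> (u @ c # v) \<in> T" "\<phi> u \<in> T" using snoc.prems \<phi>T[of "u @ c # v"] \<phi>T[of u] by auto
      have "\<phi> (u @ c # v @ [d]) = f (\<phi> (u @ c # v)) d" using \<phi>_snoc[of "u @ c # v" d] by simp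
      moreover have "lt (\<phi> u) (\<phi> (u @ c # v))" using snoc by simp
      ultimately show ?case
        using step[OF *(1), of d] snoc.prems *(2) transp_onD[OF tree(2) *(2,1)] * by auto
    qed
    then show ?thesis using w by simp
  qed
  have pred: "\<exists>s\<in>T. node_length lt T s = n \<and> lt s t" if "t \<in> T" "n < node_length lt T t" for t n
    using that
  proof (induction "node_length lt T t" arbitrary: t rule: less_induct)
    case less
    let ?B = "{s \<in> T. lt s t}"
    have B: "finite ?B" "card ?B = node_length lt T t" using tree(3) less.prems by (auto simp: lenT)
    then have "?B \<noteq> {}" using less.prems(2) by (metis card.empty not_less_zero)
    have "Max (node_length lt T ` ?B) \<in> node_length lt T ` ?B"
      using B(1) \<open>?B \<noteq> {}\<close> by (intro Max_in) auto
    then obtain m where m1: "m \<in> ?B" "Max (node_length lt T ` ?B) = node_length lt T m" by blast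
    have m: "m \<in> ?B" "\<not> lt m s" if "s \<in> ?B" for s
    proof -
      show "m \<in> ?B" by (rule m1)
      have "node_length lt T s \<le> node_length lt T m"
        unfolding m1(2)[symmetric] using B(1) that by (intro Max_ge) auto
      then show "\<not> lt m s" using length_less[of m s] m1(1) that by auto
    qed
    note mB = m1(1)
    have "{s \<in> T. lt s m} = ?B - {m}"
    proof (intro equalityI subsetI)
      fix s assume "s \<in> {s \<in> T. lt s m}"
      then show "s \<in> ?B - {m}"
        using mB less.prems(1) tree(1) transp_onD[OF tree(2), of s m t] by (auto simp: irreflp_on_def)
    next
      fix s assume s: "s \<in> ?B - {m}"
      then show "s \<in> {s \<in> T. lt s m}"
        using m(2)[of s] mB totalp_onD[OF tree(4)[OF less.prems(1)], of s m] by auto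
    qed
    then have len: "node_length lt T m = node_length lt T t - 1"
      using B mB by (simp add: lenT)
    show ?case
    proof (cases "n = node_length lt T m")
      case True
      then show ?thesis using mB by auto
    next
      case False
      then have "n < node_length lt T m" using len less.prems(2) by linarith
      then obtain s where "s \<in> T" "node_length lt T s = n" "lt s m"
        using less.hyps[of m] len less.prems mB by auto
      then show ?thesis using mB less.prems(1) transp_onD[OF tree(2), of s m t] by auto
    qed
  qed
  have surj: "t \<in> \<phi> ` words b" if "t \<in> T" for t
    using that
  proof (induction "node_length lt T t" arbitrary: t)
    case 0
    then have "t \<in> tree_level lt T 0" by (simp add: tree_level_def)
    then show ?case using r \<phi>_Nil by (metis Nil_in_words imageI singletonD)
  next
    case (Suc n)
    obtain s where s: "s \<in> T" "node_length lt T s = n" "lt s t"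
      using pred[OF Suc.prems, of n] Suc.hyps(2) by auto
    then obtain w where w: "w \<in> words b" "s = \<phi> w" using Suc.hyps(1) by blast
    have "t \<in> imm_succ lt T s" using s Suc by (simp add: imm_succ_def)
    then obtain c where "c < b" "t = f s c" using f[OF s(1)] by (auto simp: bij_betw_def)
    then have "t = \<phi> (w @ [c])" "w @ [c] \<in> words b" using w by (simp_all add: \<phi>_snoc)
    then show ?case by blast
  qed
  have inj: "u = w" if "u \<in> words b" "w \<in> words b" "\<phi> u = \<phi> w" for u w
    using that
  proof (induction u arbitrary: w rule: rev_induct)
    case Nil
    then show ?case using \<phi>T[of w] \<phi>T[of "[]"] by simp
  next
    case (snoc c u)
    then have "length w = Suc (length u)" using \<phi>T[of w] \<phi>T[of "u @ [c]"] by simp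
    then obtain d w' where w: "w = w' @ [d]" by (cases w rule: rev_cases) auto
    have ww: "u \<in> words b" "w' \<in> words b" "c < b" "d < b" using snoc.prems w by auto
    let ?t = "\<phi> w"
    have t: "?t \<in> T" "lt (\<phi> u) ?t" "lt (\<phi> w') ?t"
      using \<phi>T[of w] mono[of u "u @ [c]"] mono[of w' w] snoc.prems w by (auto simp: strict_prefix_def)
    have *: "\<phi> u \<in> T" "\<phi> w' \<in> T" "node_length lt T (\<phi> u) = node_length lt T (\<phi> w')"
      using \<phi>T[OF ww(1)] \<phi>T[OF ww(2)] \<open>length w = Suc (length u)\<close> w by auto
    have "\<not> lt (\<phi> u) (\<phi> w')" "\<not> lt (\<phi> w') (\<phi> u)"
      using length_less[OF *(1,2)] length_less[OF *(2,1)] *(3) by auto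
    then have "\<phi> u = \<phi> w'"
      using totalp_onD[OF tree(4)[OF t(1)], of "\<phi> u" "\<phi> w'"] t * by auto
    then have "u = w'" using snoc.IH ww by blast
    moreover have "c = d"
      using f[OF *(1)] snoc.prems(3) ww \<open>u = w'\<close> by (auto simp: w \<phi>_snoc bij_betw_def inj_on_def)
    ultimately show ?case using w by simp
  qed
  have "labelling lt b \<phi>"
    unfolding labelling_def
  proof (intro conjI ballI iffI)
    fix u w assume uw: "u \<in> words b" "w \<in> words b" and lt: "lt (\<phi> u) (\<phi> w)"
    have less: "length u < length w"
      using length_less[OF _ _ lt] \<phi>T[OF uw(1)] \<phi>T[OF uw(2)] by simp
    let ?v = "take (length u) w"
    have v: "?v \<in> words b" "strict_prefix ?v w" "length ?v = length u"
      using uw less by (auto simp: take_in_words strict_prefix_def take_is_prefix)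
    have "\<phi> u = \<phi> ?v"
    proof (rule ccontr)
      assume "\<phi> u \<noteq> \<phi> ?v"
      then have "lt (\<phi> u) (\<phi> ?v) \<or> lt (\<phi> ?v) (\<phi> u)"
        using totalp_onD[OF tree(4), of "\<phi> w" "\<phi> u" "\<phi> ?v"] \<phi>T uw v(1) lt mono[OF v(2) uw(2)] by auto
      then show False
        using length_less[of "\<phi> u" "\<phi> ?v"] length_less[of "\<phi> ?v" "\<phi> u"] \<phi>T[OF uw(1)] \<phi>T[OF v(1)] v(3)
        by auto
    qed
    then have "u = ?v" using inj[OF uw(1) v(1)] by simp
    then show "strict_prefix u w" using v(2) by simp
  qed (auto intro: inj_onI inj mono)
  moreover have "\<phi> ` words b = T" using surj \<phi>T by blast
  ultimately show ?thesis using that by blast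
qed


text \<open>
  A strong subtree \<open>R\<close> of height \<open>k\<close> is traced by an embedding \<open>g\<close> that follows \<open>R\<close> for as long as it can:
  above each successor of a node of \<open>R\<close> the next node of \<open>R\<close> is unique, so \<open>g\<close> finds it. Elsewhere \<open>g\<close>
  pads with zeros up to the level \<open>H\<close> that it has to respect. Beyond the levels of \<open>R\<close> these levels are
  arbitrary, which makes \<open>g\<close> total.
\<close>
lemma strong_subtree_subset_strong_emb:
  assumes \<psi>: "labelling lt b \<psi>" and b: "0 < b"
    and R: "strong_subtree lt (\<psi> ` words b) R" and ht: "tree_height lt R = enat k"
  obtains g where "g \<in> strong_emb b 0" "R \<subseteq> (\<psi> \<circ> g) ` {w \<in> words b. length w < k}"
proof -
  let ?S = "\<psi> ` words b"
  have RS: "R \<subseteq> ?S" and root: "card (tree_level lt R 0) = 1"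
    and levels: "\<And>n. \<exists>m. tree_level lt R n \<subseteq> tree_level lt ?S m"
    and unique: "\<And>s t. s \<in> R \<Longrightarrow> \<exists>u\<in>R. lt s u \<Longrightarrow> t \<in> imm_succ lt ?S s \<Longrightarrow>
      \<exists>!s'. s' \<in> imm_succ lt R s \<and> lt\<^sup>=\<^sup>= t s'"
    using R unfolding strong_subtree_def uniquely_rooted_def by blast+
  have le: "lt\<^sup>=\<^sup>= (\<psi> u) (\<psi> w) \<longleftrightarrow> prefix u w" if "u \<in> words b" "w \<in> words b" for u w
    using labelling_lt[OF \<psi> that] labelling_eq[OF \<psi> that] by (auto simp: strict_prefix_def)
  define Q where "Q = {w \<in> words b. \<psi> w \<in> R}"
  have RQ: "R = \<psi> ` Q" using RS by (auto simp: Q_def)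
  define rl where "rl w = card {u \<in> Q. strict_prefix u w}" for w
  have rl: "node_length lt R (\<psi> w) = rl w" if "w \<in> Q" for w
  proof -
    have w: "w \<in> words b" using that by (simp add: Q_def)
    have "{u. strict_prefix u w \<and> \<psi> u \<in> R} = {u \<in> Q. strict_prefix u w}"
      using prefix_in_words[OF _ w] by (auto simp: Q_def strict_prefix_def)
    then show ?thesis using labelling_node_length[OF \<psi> w RS] by (simp add: rl_def)
  qed
  have level: "\<psi> w \<in> tree_level lt R n \<longleftrightarrow> rl w = n" if "w \<in> Q" for w n
    using rl[OF that] that by (simp add: tree_level_def Q_def)
  have pred: "\<exists>u\<in>Q. strict_prefix u w \<and> rl u = n" if w: "w \<in> Q" "rl w = Suc n" for w n
  proof -
    let ?P = "{u \<in> Q. strict_prefix u w}"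
    have P: "finite ?P" "card ?P = Suc n"
      using w(2) finite_subset[OF _ finite_strict_prefixes[of w], of ?P] by (auto simp: rl_def)
    then have "length ` ?P \<noteq> {}" by (metis Zero_not_Suc card.empty image_is_empty)
    then have "Max (length ` ?P) \<in> length ` ?P" using P(1) by (intro Max_in) auto
    then obtain u where u: "u \<in> ?P" "Max (length ` ?P) = length u" by blast
    have max: "length v \<le> length u" if "v \<in> ?P" for v
      unfolding u(2)[symmetric] using P(1) that by (intro Max_ge) auto
    have "{v \<in> Q. strict_prefix v u} = ?P - {u}"
    proof (intro equalityI subsetI)
      fix v assume "v \<in> {v \<in> Q. strict_prefix v u}"
      then show "v \<in> ?P - {u}"
        using u(1) prefix_order.less_trans[of v u w] by auto
    next
      fix v assume v: "v \<in> ?P - {u}"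
      then have "prefix v w" "prefix u w" using u(1) by (auto simp: strict_prefix_def)
      then have "prefix v u" using max[of v] v by (auto intro: prefix_length_prefix)
      then show "v \<in> {v \<in> Q. strict_prefix v u}" using v by (auto simp: strict_prefix_def)
    qed
    then have "rl u = n" using P u(1) by (simp add: rl_def)
    then show ?thesis using u(1) by blast
  qed
  have down: "\<exists>u\<in>Q. rl u = n" if "w \<in> Q" "n \<le> rl w" for w n
    using that
  proof (induction "rl w - n" arbitrary: w)
    case 0
    then show ?case by auto
  next
    case (Suc i)
    then obtain u where "u \<in> Q" "rl u = rl w - 1" using pred[of w "rl w - 1"] by auto
    then show ?case using Suc.hyps(1)[of u] Suc.hyps(2) Suc.prems by auto
  qed
  have rl_k: "rl w < k" if "w \<in> Q" for w
  proof -
    let ?N = "{n. tree_level lt R n \<noteq> {}}"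
    obtain n0 where n0: "tree_level lt R n0 = {}" and k: "k = Max ?N + 1"
      using ht by (auto simp: tree_height_def split: if_splits)
    have "n < n0" if "n \<in> ?N" for n
    proof (rule ccontr)
      assume "\<not> n < n0"
      obtain s where s: "s \<in> tree_level lt R n" using \<open>n \<in> ?N\<close> by blast
      then have "s \<in> R" by (simp add: tree_level_def)
      then obtain v where v: "v \<in> Q" "s = \<psi> v" using RQ by blast
      then have "rl v = n" using level[OF v(1)] s by simp
      with v(1) obtain u where "u \<in> Q" "rl u = n0" using down[of v n0] \<open>\<not> n < n0\<close> by auto
      then show False using level n0 by blast
    qed
    then have "finite ?N" by (meson bounded_nat_set_is_finite)
    moreover have "rl w \<in> ?N" using level[OF that] by blast
    ultimately have "rl w \<le> Max ?N" by (rule Max_ge)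
    then show ?thesis using k by simp
  qed
  have "\<exists>m. \<forall>w\<in>Q. rl w = n \<longrightarrow> length w = m" for n
  proof -
    obtain m where m: "tree_level lt R n \<subseteq> tree_level lt ?S m" using levels by blast
    have "length w = m" if "w \<in> Q" "rl w = n" for w
    proof -
      have "\<psi> w \<in> tree_level lt ?S m" using level[OF that(1)] that(2) m by blast
      then show ?thesis
        using labelling_node_length_full[OF \<psi>, of w] that(1) by (simp add: tree_level_def Q_def)
    qed
    then show ?thesis by blast
  qed
  then obtain L where L: "\<And>n w. w \<in> Q \<Longrightarrow> rl w = n \<Longrightarrow> length w = L n" by metis
  \<comment> \<open>The levels of the ambient tree that carry the levels of \<open>R\<close>; the maximum forces strict growth where
    \<open>L\<close> is meaningless, namely beyond the height of \<open>R\<close>.\<close>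
  define H where "H = rec_nat (L 0) (\<lambda>n x. max (Suc x) (L (Suc n)))"
  have H_Suc: "H (Suc n) = max (Suc (H n)) (L (Suc n))" and H_0: "H 0 = L 0" for n
    by (simp_all add: H_def)
  have H: "length w = H n" if "w \<in> Q" "rl w = n" for w n
    using that
  proof (induction n arbitrary: w)
    case 0
    then show ?case using L H_0 by simp
  next
    case (Suc n)
    then obtain u where u: "u \<in> Q" "strict_prefix u w" "rl u = n" using pred by blast
    then have "Suc (H n) \<le> length w" using Suc.IH prefix_length_less[of u w] by auto
    then show ?case using L[OF Suc.prems] by (simp add: H_Suc)
  qed
  obtain r where r: "r \<in> Q" "\<And>w. w \<in> Q \<Longrightarrow> rl w = 0 \<Longrightarrow> w = r" and r0: "rl r = 0"
  proof -
    obtain s where s: "tree_level lt R 0 = {s}" using root by (auto simp: card_1_singleton_iff)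
    then have "s \<in> R" by (auto simp: tree_level_def)
    then obtain r where r: "r \<in> Q" "s = \<psi> r" using RQ by blast
    then have "rl r = 0" using level[OF r(1), of 0] s by simp
    moreover have "w = r" if "w \<in> Q" "rl w = 0" for w
      using level[OF that(1), of 0] that s r labelling_eq[OF \<psi>, of w r] by (auto simp: Q_def)
    ultimately show ?thesis using that r(1) by blast
  qed
  define next_node where "next_node n x c y \<longleftrightarrow> y \<in> Q \<and> rl y = Suc n \<and> prefix (x @ [c]) y" for n x c y
  define nxt where "nxt n x c = (if \<exists>y. next_node n x c y then SOME y. next_node n x c y
    else x @ c # replicate (H (Suc n) - Suc (length x)) 0)" for n x c
  define G where "G = foldl (\<lambda>(n, x) c. (Suc n, nxt n x c)) (0, r)"
  have G_Nil: "G [] = (0, r)"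
    and G_snoc: "G (w @ [c]) = (Suc (fst (G w)), nxt (fst (G w)) (snd (G w)) c)" for w c
    by (simp_all add: G_def split_beta)
  have fst_G: "fst (G w) = length w" for w
    by (induction w rule: rev_induct) (simp_all add: G_Nil G_snoc)
  define g where "g w = (if w \<in> words b then snd (G w) else w)" for w
  have g_Nil: "g [] = r" by (simp add: g_def G_Nil)
  have g_snoc: "g (w @ [c]) = nxt (length w) (g w) c" if "w @ [c] \<in> words b" for w c
    using that by (simp add: g_def G_snoc fst_G)
  have nxt: "nxt n x c \<in> words b \<and> length (nxt n x c) = H (Suc n) \<and> prefix (x @ [c]) (nxt n x c)"
    if "x \<in> words b" "length x = H n" "c < b" for n x c
  proof (cases "\<exists>y. next_node n x c y")
    case True
    then have "next_node n x c (nxt n x c)" unfolding nxt_def by (simp add: someI_ex)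
    then show ?thesis using H by (auto simp: next_node_def Q_def)
  next
    case False
    then show ?thesis using that b H_Suc[of n] by (auto simp: nxt_def words_def)
  qed
  have g: "g w \<in> words b \<and> length (g w) = H (length w)" if "w \<in> words b" for w
    using that
  proof (induction w rule: rev_induct)
    case Nil
    then show ?case using r(1) H[OF r(1) r0] by (simp add: g_Nil Q_def)
  next
    case (snoc c w)
    then show ?case using nxt[of "g w" "length w" c] g_snoc[of w c] by simp
  qed
  have "g \<in> strong_emb b 0"
  proof (rule strong_embI)
    fix w c assume "w \<in> words b" "c < (b::nat)"
    then show "prefix (g w @ [c]) (g (w @ [c]))"
      using nxt[of "g w" "length w" c] g g_snoc[of w c] by simp
  qed (use g in \<open>auto simp: g_def\<close>)
  moreover have cover: "\<exists>v\<in>words b. length v = n \<and> g v = w" if "w \<in> Q" "rl w = n" for w n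
    using that
  proof (induction n arbitrary: w)
    case 0
    then show ?case using r(2) g_Nil by (intro bexI[of _ "[]"]) auto
  next
    case (Suc n)
    then obtain u where u: "u \<in> Q" "strict_prefix u w" "rl u = n" using pred by blast
    then obtain v where v: "v \<in> words b" "length v = n" "g v = u" using Suc.IH by blast
    obtain c z where w: "w = u @ c # z" using u(2) by (auto elim: strict_prefixE')
    have words: "w \<in> words b" "u \<in> words b" "c < b" using Suc.prems(1) w by (auto simp: Q_def)
    have nw: "next_node n u c w" using Suc.prems w by (simp add: next_node_def)
    then have ny: "next_node n u c (nxt n u c)" unfolding nxt_def by (auto intro: someI)
    have succ: "\<psi> y \<in> imm_succ lt R (\<psi> u) \<and> lt\<^sup>=\<^sup>= (\<psi> (u @ [c])) (\<psi> y)" if y: "next_node n u c y" for y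
    proof -
      have "y \<in> Q" "y \<in> words b" "prefix (u @ [c]) y" "rl y = Suc n"
        using y by (auto simp: next_node_def Q_def)
      then show ?thesis
        using le[of u y] le[of "u @ [c]" y] words rl[of y] rl[OF u(1)] u(3)
        by (auto simp: imm_succ_def Q_def dest: append_prefixD)
    qed
    have "\<psi> (u @ [c]) \<in> imm_succ lt ?S (\<psi> u)"
      unfolding labelling_imm_succ_full[OF \<psi> words(2)] using words(3) by blast
    moreover have "\<psi> u \<in> R" "\<psi> w \<in> R" using u(1) Suc.prems(1) by (auto simp: Q_def)
    moreover have "lt (\<psi> u) (\<psi> w)" using labelling_lt[OF \<psi> words(2,1)] u(2) by simp
    ultimately have "\<psi> (nxt n u c) = \<psi> w"
      using unique[of "\<psi> u" "\<psi> (u @ [c])"] succ[OF nw] succ[OF ny] by blast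
    then have "nxt n u c = w"
      using labelling_eq[OF \<psi>, of "nxt n u c" w] ny words(1) by (auto simp: next_node_def Q_def)
    then have "g (v @ [c]) = w" using g_snoc[of v c] v words(3) by simp
    then show ?case using v words(3) by (intro bexI[of _ "v @ [c]"]) auto
  qed
  have "R \<subseteq> (\<psi> \<circ> g) ` {w \<in> words b. length w < k}"
  proof
    fix s assume "s \<in> R"
    then obtain w where w: "w \<in> Q" "s = \<psi> w" unfolding RQ by blast
    then obtain v where "v \<in> words b" "length v = rl w" "g v = w" using cover by blast
    then show "s \<in> (\<psi> \<circ> g) ` {w \<in> words b. length w < k}" using rl_k[OF w(1)] w(2) by auto
  qed
  ultimately show ?thesis using that by blast
qed

section \<open>Events indexed by a homogeneous tree\<close>

text \<open>
  The exponent is a natural number, so real powers reduce to ordinary ones.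
\<close>
lemma p_exponent_eq_sum:
  assumes "2 \<le> b"
  shows "p_exponent b k = real (\<Sum>j<k. (2 ^ b - 1) ^ j)"
proof -
  have "(2::real) ^ 2 \<le> 2 ^ b" using assms by (intro power_increasing) auto
  then have "(\<Sum>j<k. ((2::real) ^ b - 1) ^ j) = ((2 ^ b - 1) ^ k - 1) / ((2 ^ b - 1) - 1)"
    by (intro geometric_sum) simp
  then show ?thesis by (simp add: p_exponent_def of_nat_diff)
qed

theorem theorem1:
  fixes lt :: "'a \<Rightarrow> 'a \<Rightarrow> bool"
    and T :: "'a set"
    and b :: nat
    and M :: "'w measure"
    and A :: "'a \<Rightarrow> 'w set"
    and \<epsilon> \<theta> :: real
  assumes "homogeneous_tree lt T b"
    and "prob_space M"
    and "\<And>t. t \<in> T \<Longrightarrow> A t \<in> sets M"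
    and "\<epsilon> > 0"
    and "\<And>t. t \<in> T \<Longrightarrow> measure M (A t) \<ge> \<epsilon>"
    and "0 < \<theta>" "\<theta> < \<epsilon>"
  shows "\<exists>S. strong_subtree lt T S \<and> tree_height lt S = \<infinity> \<and>
           (\<forall>k R. k \<ge> 1 \<longrightarrow> strong_subtree lt S R \<longrightarrow> tree_height lt R = enat k \<longrightarrow>
              measure M (\<Inter>t\<in>R. A t) \<ge> \<theta> powr p_exponent b k)"
proof -
  interpret prob_space M by fact
  have b2: "2 \<le> b" using assms(1) by (simp add: homogeneous_tree_def)
  then have b: "0 < b" by simp
  obtain \<phi> where \<phi>: "labelling lt b \<phi>" and T: "\<phi> ` words b = T"
    using homogeneous_tree_labelling[OF assms(1)] by blast
  define P where "P k f \<longleftrightarrow>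
    \<theta> ^ (\<Sum>j<k. (2 ^ b - 1) ^ j) \<le> prob (\<Inter>w\<in>{w \<in> words b. length w < k}. A (\<phi> (f w)))" for k f
  obtain e where e: "e \<in> strong_emb b 0"
    and good: "\<And>g k. g \<in> strong_emb b 0 \<Longrightarrow> \<not> (1 \<le> k \<and> \<not> P k (e \<circ> g))"
  proof (rule milliken_closed[OF b, of "\<lambda>k f. 1 \<le> k \<and> \<not> P k f"])
    fix k :: nat and f f' :: "nat list \<Rightarrow> nat list"
    assume "\<And>w. w \<in> words b \<Longrightarrow> length w < k \<Longrightarrow> f w = f' w"
    then have "(\<Inter>w\<in>{w \<in> words b. length w < k}. A (\<phi> (f w))) = (\<Inter>w\<in>{w \<in> words b. length w < k}. A (\<phi> (f' w)))"
      by simp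
    then show "(1 \<le> k \<and> \<not> P k f) = (1 \<le> k \<and> \<not> P k f')" by (simp add: P_def)
  next
    fix e assume e: "e \<in> strong_emb b 0"
    have "\<phi> (e w) \<in> T" if "w \<in> words b" for w using T strong_emb_words[OF e that] by blast
    then obtain g where "g \<in> strong_emb b 0" "\<And>k. 1 \<le> k \<Longrightarrow>
        \<theta> ^ (\<Sum>j<k. (2 ^ b - 1) ^ j) \<le> prob (\<Inter>w\<in>{w \<in> words b. length w < k}. A (\<phi> (e (g w))))"
      using strong_emb_initial_segments[OF b, of "\<lambda>w. A (\<phi> (e w))" \<epsilon> \<theta>] assms(3,5-7) by blast
    then show "\<exists>g\<in>strong_emb b 0. \<forall>k. \<not> (1 \<le> k \<and> \<not> P k (e \<circ> g))"
      by (intro bexI[of _ g]) (auto simp: P_def)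
  qed blast
  define S where "S = (\<phi> \<circ> e) ` words b"
  have \<psi>: "labelling lt b (\<phi> \<circ> e)" using \<phi> e by (rule labelling_comp_strong_emb)
  have "strong_subtree lt T S"
    unfolding S_def T[symmetric] using \<phi> e b by (rule labelling_strong_subtree)
  moreover have "tree_height lt S = \<infinity>"
    unfolding S_def using \<psi> b by (rule labelling_infinite_height)
  moreover have "\<theta> powr p_exponent b k \<le> prob (\<Inter>t\<in>R. A t)"
    if k: "1 \<le> k" and R: "strong_subtree lt S R" "tree_height lt R = enat k" for k R
  proof -
    let ?W = "{w \<in> words b. length w < k}"
    obtain g where g: "g \<in> strong_emb b 0" "R \<subseteq> (\<phi> \<circ> e \<circ> g) ` ?W"
      using strong_subtree_subset_strong_emb[OF \<psi> b R(1)[unfolded S_def] R(2)] by blast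
    have "R \<noteq> {}" using R(1) by (auto simp: strong_subtree_def uniquely_rooted_def tree_level_def)
    moreover have "finite R" using g(2) finite_words_below by (rule finite_subset[OF _ finite_imageI])
    moreover have "R \<subseteq> T"
      using R(1) \<open>strong_subtree lt T S\<close> by (auto simp: strong_subtree_def)
    ultimately have "(\<Inter>t\<in>R. A t) \<in> events" using assms(3) by (intro sets.finite_INT) auto
    moreover have "(\<Inter>w\<in>?W. A (\<phi> ((e \<circ> g) w))) \<subseteq> (\<Inter>t\<in>R. A t)" using g(2) by fastforce
    ultimately have "prob (\<Inter>w\<in>?W. A (\<phi> ((e \<circ> g) w))) \<le> prob (\<Inter>t\<in>R. A t)"
      by (intro finite_measure_mono)
    moreover have "P k (e \<circ> g)" using good[OF g(1), of k] k by blast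
    ultimately show ?thesis
      unfolding P_def p_exponent_eq_sum[OF b2] powr_realpow[OF assms(6)] by (rule order_trans[rotated])
  qed
  ultimately show ?thesis by blast
qed

end
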